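(* Let $H\sim W_m(n_H,\ \sigma^2 I,\ (\omega/\sigma^2)\, v v^T)$ with $v\in\mathbb{R}^m$, $\|v\|=1$, $\omega>0$, and let $\ell_1$ be the largest eigenvalue of $H$. Then, with $(m,n_H,\omega)$ fixed, as $\sigma\to 0$, $$\ell_1=\sigma^2\,\chi^2_{n_H}(\omega/\sigma^2)+\chi^2_{m-1}\,\sigma^2+\frac{\chi^2_{m-1}\,\chi^2_{n_H-1}}{\sigma^2\,\chi^2_{n_H}(\omega/\sigma^2)}\,\sigma^4+o_p(\sigma^4),$$ where the three variates $\chi^2_{n_H}(\omega/\sigma^2)$, $\chi^2_{m-1}$ and $\chi^2_{n_H-1}$ are independent (and each symbol denotes the same random variable at every occurrence).
   Context: Noncentral Wishart distribution: if $z_i\sim N_m(\mu_i,\Sigma)$, $i=1,\dots,n$, are independent, $Z^T=[z_1,\dots,z_n]$ and $M^T=[\mu_1,\dots,\mu_n]$, then $Z^TZ$ has the distribution $W_m(n,\Sigma,\Omega)$ with $n$ degrees of freedom, covariance matrix $\Sigma$ and noncentrality matrix $\Omega=\Sigma^{-1}M^TM$. $\chi^2_k$ denotes a random variable with the central chi-squared distribution with $k$ degrees of freedom ($\chi^2_0\equiv0$), and $\chi^2_k(\theta)$ a noncentral chi-squared variable with $k$ degrees of freedom and noncentrality parameter $\theta$ (the law of $\sum_{i=1}^k g_i^2$ with independent $g_i\sim N(a_i,1)$ and $\sum a_i^2=\theta$). The displayed equality is a stochastic representation: for each $\sigma>0$ the matrix $H$ and independent variates with the stated distributions can be realized on a common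 probability space so that the equality holds, and $o_p(\sigma^4)$ denotes a random remainder which, divided by $\sigma^4$, tends to $0$ in probability as $\sigma\to0$. *)

theory Defs
  imports "HOL-Probability.Probability"
begin

definition sym_pos_def :: "real^'m^'m \<Rightarrow> bool" where
  "sym_pos_def S \<longleftrightarrow> transpose S = S \<and> (\<forall>x. x \<noteq> 0 \<longrightarrow> x \<bullet> (S *v x) > 0)"

definition outer_prod :: "real^'m \<Rightarrow> real^'m \<Rightarrow> real^'m^'m" where
  "outer_prod x y = (\<chi> i j. x $ i * y $ j)"

(* For positive definite S, the law N_m(mu, S) with m = CARD('m). *)
definition mvnormal :: "real^'m \<Rightarrow> real^'m^'m \<Rightarrow> (real^'m) measure" where
  "mvnormal \<mu> S = density lborel (\<lambda>x. ennreal
     (exp (- ((x - \<mu>) \<bullet> (matrix_inv S *v (x - \<mu>))) / 2) / sqrt ((2 * pi) ^ CARD('m) * det S)))"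

(* Z^T Z for the matrix Z whose rows are z 0, ..., z (n - 1). *)
definition gram :: "nat \<Rightarrow> (nat \<Rightarrow> real^'m) \<Rightarrow> real^'m^'m" where
  "gram n z = (\<Sum>i<n. outer_prod (z i) (z i))"

(* D is the law W_m(n, S, \<Omega>).  The means \<mu> enter the law of gram n z only through
   gram n \<mu>, so D is determined by n, S and \<Omega>. *)
definition noncentral_wishart ::
    "nat \<Rightarrow> real^'m^'m \<Rightarrow> real^'m^'m \<Rightarrow> (real^'m^'m) measure \<Rightarrow> bool" where
  "noncentral_wishart n S \<Omega> D \<longleftrightarrow> sym_pos_def S \<and>
     (\<exists>\<mu>. \<Omega> = matrix_inv S ** gram n \<mu> \<and>
          D = distr (\<Pi>\<^sub>M i\<in>{..<n}. mvnormal (\<mu> i) S) borel (gram n))"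

(* D is the chi-squared law with k degrees of freedom and noncentrality \<theta>; it depends on
   the means a only through the sum of their squares.  For k = 0 (which forces \<theta> = 0) it is
   the point mass at 0. *)
definition noncentral_chisq :: "nat \<Rightarrow> real \<Rightarrow> real measure \<Rightarrow> bool" where
  "noncentral_chisq k \<theta> D \<longleftrightarrow>
     (\<exists>a. (\<Sum>i<k. (a i)\<^sup>2) = \<theta> \<and>
          D = distr (\<Pi>\<^sub>M i\<in>{..<k}. density lborel (normal_density (a i) 1)) borel
                (\<lambda>g. \<Sum>i<k. (g i)\<^sup>2))"

abbreviation central_chisq :: "nat \<Rightarrow> real measure \<Rightarrow> bool" where
  "central_chisq k \<equiv> noncentral_chisq k 0"

(* Meaningful for symmetric A, whose set of (real) eigenvalues is finite and nonempty. *)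
definition largest_eigenvalue :: "real^'m^'m \<Rightarrow> real" where
  "largest_eigenvalue A = Max {l. \<exists>x. x \<noteq> 0 \<and> A *v x = l *\<^sub>R x}"

(* R = o_p(r) along F; the probability space may vary with the parameter. *)
definition small_op :: "('p \<Rightarrow> 'a measure) \<Rightarrow> ('p \<Rightarrow> 'a \<Rightarrow> real) \<Rightarrow> ('p \<Rightarrow> real) \<Rightarrow> 'p filter \<Rightarrow> bool" where
  "small_op P R r F \<longleftrightarrow>
     (\<forall>\<epsilon>>0. ((\<lambda>s. measure (P s) {x \<in> space (P s). \<bar>R s x / r s\<bar> > \<epsilon>}) \<longlongrightarrow> 0) F)"

(* Rank-one noncentrality requires at least one degree of freedom; then the law exists. *)
lemma noncentral_wishart_exists:
  fixes v :: "real^'m"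
  assumes "0 < n" "0 < \<omega>" "0 < s"
  shows "\<exists>D. noncentral_wishart n (s *\<^sub>R mat 1) ((\<omega> / s) *\<^sub>R outer_prod v v) D"
proof -
  let ?S = "s *\<^sub>R mat 1 :: real^'m^'m"
  define \<mu> where "\<mu> = (\<lambda>i::nat. if i = 0 then sqrt \<omega> *\<^sub>R v else 0)"
  have sc: "(c *\<^sub>R mat 1) ** A = c *\<^sub>R A" for c and A :: "real^'m^'m"
    by (simp add: vec_eq_iff matrix_matrix_mult_def mat_def if_distrib if_distribR sum.delta'
        cong: if_cong)
  have "?S ** ((1 / s) *\<^sub>R mat 1) = mat 1" "((1 / s) *\<^sub>R mat 1) ** ?S = mat 1"
    using assms by (simp_all add: sc)
  then have "?S ** matrix_inv ?S = mat 1"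
    unfolding matrix_inv_def by (metis (mono_tags, lifting) someI_ex)
  then have "s *\<^sub>R matrix_inv ?S = mat 1" by (simp add: sc)
  then have "(1 / s) *\<^sub>R (s *\<^sub>R matrix_inv ?S) = (1 / s) *\<^sub>R mat 1" by simp
  then have inv: "matrix_inv ?S = (1 / s) *\<^sub>R mat 1" using assms by simp
  have "transpose ?S = ?S" by (auto simp: transpose_def mat_def vec_eq_iff)
  then have pd: "sym_pos_def ?S"
    using assms by (simp add: sym_pos_def_def scaleR_matrix_vector_assoc[symmetric])
  have "gram n \<mu> = (\<Sum>i<n. if i = 0 then \<omega> *\<^sub>R outer_prod v v else 0)"
    unfolding gram_def \<mu>_def
    by (intro sum.cong) (use assms in \<open>auto simp: outer_prod_def vec_eq_iff\<close>)
  also have "\<dots> = \<omega> *\<^sub>R outer_prod v v" using assms by (simp add: sum.delta)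
  finally have "(\<omega> / s) *\<^sub>R outer_prod v v = matrix_inv ?S ** gram n \<mu>"
    by (simp add: inv sc)
  with pd show ?thesis unfolding noncentral_wishart_def by blast
qed

end

theory Submission
  imports Defs
begin

text \<open>
  The means are multiples of \<open>v\<close>, so the \<open>i\<close>-th row is \<open>z\<^sub>i = x\<^sub>i v + \<sigma> y\<^sub>i\<close> with \<open>x\<^sub>i = c\<^sub>i + \<sigma> h\<^sub>i\<close>,
  \<open>h\<^sub>i\<close> standard normal and \<open>y\<^sub>i\<close> an independent standard Gaussian vector orthogonal to \<open>v\<close>.
  Put \<open>q = x / |x|\<close> and \<open>b = \<Sum> q\<^sub>i y\<^sub>i\<close>. For fixed \<open>x\<close>, rotation invariance makes \<open>b\<close> standard Gaussian
  and the residual \<open>S = \<Sum> y\<^sub>i y\<^sub>i\<^sup>T - b b\<^sup>T\<close> an independent Gram matrix with \<open>n - 1\<close> degrees of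
  freedom; as this law does not depend on \<open>x\<close>, the variates \<open>A = |x|\<^sup>2 / \<sigma>\<^sup>2\<close>, \<open>B = |b|\<^sup>2\<close> and
  \<open>C = b\<^sup>T S b / |b|\<^sup>2\<close> are independent with the three chi-squared laws. With \<open>k = |x| v + \<sigma> b\<close> one has
  \<open>H = k k\<^sup>T + \<sigma>\<^sup>2 S\<close>, a perturbation of a rank-one matrix, whose largest eigenvalue is
  \<open>|k|\<^sup>2 + \<sigma>\<^sup>2 k\<^sup>T S k / |k|\<^sup>2\<close> up to \<open>O(\<sigma>\<^sup>6)\<close>. Since \<open>|x|\<^sup>2\<close> stays away from \<open>0\<close> this is the
  claimed expansion, with a remainder divided by \<open>\<sigma>\<^sup>4\<close> that vanishes pointwise, hence in probability.
\<close>

section \<open>Product measures\<close>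

lemma emeasure_distr_indicator:
  assumes [measurable]: "f \<in> M \<rightarrow>\<^sub>M N" "A \<in> sets N"
  shows "emeasure (distr M N f) A = (\<integral>\<^sup>+x. indicator A (f x) \<partial>M)"
proof -
  have "emeasure (distr M N f) A = (\<integral>\<^sup>+y. indicator A y \<partial>distr M N f)" by simp
  also have "\<dots> = (\<integral>\<^sup>+x. indicator A (f x) \<partial>M)" by (rule nn_integral_distr) auto
  finally show ?thesis .
qed

text \<open>Both measures agree on boxes, where the integral of a product over a product space
  factorises. The assumptions cover all indices because \<open>product_sigma_finite\<close>
  does.\<close>

lemma PiM_density:
  assumes I: "finite I" and M: "\<And>i. prob_space (density (M i) (f i))" "\<And>i. sigma_finite_measure (M i)"
    and f [measurable]: "\<And>i. f i \<in> borel_measurable (M i)"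
  shows "(\<Pi>\<^sub>M i\<in>I. density (M i) (f i)) = density (PiM I M) (\<lambda>x. \<Prod>i\<in>I. f i (x i))"
proof (rule product_sigma_finite.PiM_eqI[symmetric, OF _ I])
  interpret product_sigma_finite M by (simp add: product_sigma_finite_def M)
  show "product_sigma_finite (\<lambda>i. density (M i) (f i))"
    by (simp add: product_sigma_finite_def M prob_space_imp_sigma_finite)
  fix A assume A: "\<And>i. i \<in> I \<Longrightarrow> A i \<in> sets (density (M i) (f i))"
  then have A': "\<And>i. i \<in> I \<Longrightarrow> A i \<in> sets (M i)" by simp
  have ind: "indicator (Pi\<^sub>E I A) x = (\<Prod>i\<in>I. indicator (A i) (x i) :: ennreal)"
    if "x \<in> space (PiM I M)" for x
    using that I by (auto simp: indicator_def space_PiM PiE_iff prod_zero_iff)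
  have "emeasure (density (PiM I M) (\<lambda>x. \<Prod>i\<in>I. f i (x i))) (Pi\<^sub>E I A) =
      (\<integral>\<^sup>+x. (\<Prod>i\<in>I. f i (x i) * indicator (A i) (x i)) \<partial>PiM I M)"
    using A' I by (subst emeasure_density)
      (auto intro!: nn_integral_cong sets_PiM_I_finite simp: ind prod.distrib)
  also have "\<dots> = (\<Prod>i\<in>I. \<integral>\<^sup>+x. f i x * indicator (A i) x \<partial>M i)"
    using A' I by (intro product_nn_integral_prod) auto
  also have "\<dots> = (\<Prod>i\<in>I. emeasure (density (M i) (f i)) (A i))"
    using A' by (intro prod.cong) (auto simp: emeasure_density)
  finally show "emeasure (density (PiM I M) (\<lambda>x. \<Prod>i\<in>I. f i (x i))) (Pi\<^sub>E I A) =
      (\<Prod>i\<in>I. emeasure (density (M i) (f i)) (A i))" .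
qed (auto intro!: sets_PiM_cong)

text \<open>Each row of the data matrix is a function of its own pair of Gaussian vectors, so this
  yields the joint law of the rows. On boxes the indicator is a product over the indices, and two
  product integrals separate them.\<close>

lemma distr_PiM_map2:
  assumes I: "finite I" and N: "\<And>i. prob_space (N i)" "\<And>i. prob_space (N' i)"
    and f [measurable]: "\<And>i. i \<in> I \<Longrightarrow> f i \<in> N i \<Otimes>\<^sub>M N' i \<rightarrow>\<^sub>M K i"
  shows "distr (PiM I N \<Otimes>\<^sub>M PiM I N') (PiM I K) (\<lambda>(x, y). \<lambda>i\<in>I. f i (x i, y i)) =
    (\<Pi>\<^sub>M i\<in>I. distr (N i \<Otimes>\<^sub>M N' i) (K i) (f i))" (is "?L = _")
proof -
  \<comment> \<open>Outside \<open>I\<close> nothing is known about \<open>f i\<close>, so a point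
    mass fills in there to keep every \<open>D i\<close> a probability measure.\<close>
  define D where "D i = (if i \<in> I then distr (N i \<Otimes>\<^sub>M N' i) (K i) (f i) else return (count_space UNIV) undefined)" for i
  interpret N: prob_space "N i" for i by (rule N)
  interpret N': prob_space "N' i" for i by (rule N)
  interpret NN: pair_prob_space "N i" "N' i" for i ..
  interpret P: product_prob_space N by standard
  interpret P': product_prob_space N' by standard
  have PI': "sigma_finite_measure (PiM I N')"
    by (intro prob_space_imp_sigma_finite prob_space_PiM N)
  have D: "prob_space (D i)" for i
    by (auto simp: D_def intro!: NN.prob_space_distr prob_space_return)
  have [measurable]: "(\<lambda>(x, y). \<lambda>i\<in>I. f i (x i, y i)) \<in> PiM I N \<Otimes>\<^sub>M PiM I N' \<rightarrow>\<^sub>M PiM I K"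
    unfolding split_beta by (rule measurable_restrict) measurable
  have "?L = PiM I D"
  proof (rule product_sigma_finite.PiM_eqI[OF _ I])
    show "product_sigma_finite D" 
      by (simp add: product_sigma_finite_def D prob_space_imp_sigma_finite)
    show "sets ?L = sets (PiM I D)" by (auto intro!: sets_PiM_cong simp: D_def)
    fix A assume "\<And>i. i \<in> I \<Longrightarrow> A i \<in> sets (D i)"
    then have A [measurable]: "\<And>i. i \<in> I \<Longrightarrow> A i \<in> sets (K i)" by (auto simp: D_def)
    have "emeasure ?L (Pi\<^sub>E I A) = (\<integral>\<^sup>+z. indicator (Pi\<^sub>E I A) ((\<lambda>(x, y). \<lambda>i\<in>I. f i (x i, y i)) z) \<partial>(PiM I N \<Otimes>\<^sub>M PiM I N'))"
      using I by (intro emeasure_distr_indicator) (auto intro!: sets_PiM_I_finite)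
    also have "\<dots> = (\<integral>\<^sup>+x. \<integral>\<^sup>+y. indicator (Pi\<^sub>E I A) (\<lambda>i\<in>I. f i (x i, y i)) \<partial>PiM I N' \<partial>PiM I N)"
      using I by (subst sigma_finite_measure.nn_integral_fst[OF PI', symmetric]) auto
    also have "\<dots> = (\<integral>\<^sup>+x. \<integral>\<^sup>+y. (\<Prod>i\<in>I. indicator (A i) (f i (x i, y i))) \<partial>PiM I N' \<partial>PiM I N)"
      using I by (intro nn_integral_cong) (auto simp: indicator_def prod_zero_iff PiE_iff)
    also have "\<dots> = (\<integral>\<^sup>+x. (\<Prod>i\<in>I. \<integral>\<^sup>+y. indicator (A i) (f i (x i, y)) \<partial>N' i) \<partial>PiM I N)"
      using I by (intro nn_integral_cong P'.product_nn_integral_prod) (auto simp: space_PiM PiE_iff)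
    also have "\<dots> = (\<Prod>i\<in>I. \<integral>\<^sup>+x. \<integral>\<^sup>+y. indicator (A i) (f i (x, y)) \<partial>N' i \<partial>N i)"
      using I by (intro P.product_nn_integral_prod) auto
    also have "\<dots> = (\<Prod>i\<in>I. emeasure (D i) (A i))"
    proof (intro prod.cong refl)
      fix i assume i: "i \<in> I"
      note [measurable] = f[OF i] A[OF i]
      show "(\<integral>\<^sup>+x. \<integral>\<^sup>+y. indicator (A i) (f i (x, y)) \<partial>N' i \<partial>N i) = emeasure (D i) (A i)"
        using i by (subst N'.nn_integral_fst)
          (auto simp: D_def emeasure_distr_indicator)
    qed
    finally show "emeasure ?L (Pi\<^sub>E I A) = (\<Prod>i\<in>I. emeasure (D i) (A i))" .
  qed
  also have "\<dots> = (\<Pi>\<^sub>M i\<in>I. distr (N i \<Otimes>\<^sub>M N' i) (K i) (f i))"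
    by (intro PiM_cong) (auto simp: D_def)
  finally show ?thesis .
qed

lemma distr_fst_comp:
  assumes "prob_space M" "f \<in> N \<rightarrow>\<^sub>M K"
  shows "distr (N \<Otimes>\<^sub>M M) K (\<lambda>z. f (fst z)) = distr N K f"
proof -
  interpret prob_space M by fact
  have "distr (N \<Otimes>\<^sub>M M) K (\<lambda>z. f (fst z)) = distr (distr (N \<Otimes>\<^sub>M M) N fst) K f"
    using assms by (subst distr_distr) (auto simp: comp_def)
  then show ?thesis by (simp add: distr_pair_fst)
qed

lemma distr_snd_comp:
  assumes "prob_space N" "prob_space M" "f \<in> M \<rightarrow>\<^sub>M K"
  shows "distr (N \<Otimes>\<^sub>M M) K (\<lambda>z. f (snd z)) = distr M K f"
proof -
  interpret M: prob_space M by fact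
  interpret N: prob_space N by fact
  interpret pair_sigma_finite N M ..
  have "distr (N \<Otimes>\<^sub>M M) K (\<lambda>z. f (snd z)) =
      distr (distr (M \<Otimes>\<^sub>M N) (N \<Otimes>\<^sub>M M) (\<lambda>(x, y). (y, x))) K (\<lambda>z. f (snd z))"
    by (simp flip: distr_pair_swap)
  also have "\<dots> = distr (M \<Otimes>\<^sub>M N) K (\<lambda>z. f (fst z))"
    using assms by (subst distr_distr) (auto simp: comp_def split_beta)
  finally show ?thesis using assms by (simp add: distr_fst_comp)
qed

text \<open>Obtained from the two-variable version by adjoining an independent copy of
  \<open>N\<close> that the maps ignore.\<close>

lemma distr_PiM_map:
  assumes I: "finite I" and N: "\<And>i. prob_space (N i)"
    and f [measurable]: "\<And>i. i \<in> I \<Longrightarrow> f i \<in> N i \<rightarrow>\<^sub>M K i"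
  shows "distr (PiM I N) (PiM I K) (\<lambda>x. \<lambda>i\<in>I. f i (x i)) = (\<Pi>\<^sub>M i\<in>I. distr (N i) (K i) (f i))"
proof -
  have "distr (PiM I N) (PiM I K) (\<lambda>x. \<lambda>i\<in>I. f i (x i)) =
      distr (PiM I N \<Otimes>\<^sub>M PiM I N) (PiM I K) (\<lambda>z. \<lambda>i\<in>I. f i (fst z i))"
    by (rule distr_fst_comp[symmetric]) (auto intro!: prob_space_PiM N)
  also have "\<dots> = (\<Pi>\<^sub>M i\<in>I. distr (N i \<Otimes>\<^sub>M N i) (K i) (\<lambda>z. f i (fst z)))"
    using distr_PiM_map2[OF I N N, where f="\<lambda>i z. f i (fst z)" and K=K] by (simp add: split_beta')
  also have "\<dots> = (\<Pi>\<^sub>M i\<in>I. distr (N i) (K i) (f i))"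
    by (intro PiM_cong refl distr_fst_comp N f)
  finally show ?thesis .
qed

text \<open>Integrating out the second variable first leaves the constant factor
  \<open>emeasure L B\<close>, so \<open>h\<close> is independent of whatever is computed from the
  first variable. This is how random directions are decoupled from the variates built on
  them.\<close>

lemma distr_pair_kernel:
  assumes M: "prob_space M" and N: "prob_space N"
    and f [measurable]: "f \<in> M \<rightarrow>\<^sub>M M'" and h [measurable]: "h \<in> M \<Otimes>\<^sub>M N \<rightarrow>\<^sub>M K"
    and L: "\<And>x. x \<in> space M \<Longrightarrow> distr N K (\<lambda>y. h (x, y)) = L"
  shows "distr (M \<Otimes>\<^sub>M N) (M' \<Otimes>\<^sub>M K) (\<lambda>z. (f (fst z), h z)) = distr M M' f \<Otimes>\<^sub>M L"
proof (rule pair_measure_eqI[symmetric])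
  interpret M: prob_space M by fact
  interpret N: prob_space N by fact
  \<comment> \<open>One sample point suffices to see that \<open>L\<close> is a probability measure
    with the sigma-algebra of \<open>K\<close>.\<close>
  obtain x0 where x0: "x0 \<in> space M" using M.not_empty by blast
  have sL [measurable_cong]: "sets L = sets K" using L[OF x0] by (metis sets_distr)
  have "prob_space L" using L[OF x0] x0 by (metis N.prob_space_distr measurable_Pair2 h)
  then show "sigma_finite_measure L" by (rule prob_space_imp_sigma_finite)
  show "sigma_finite_measure (distr M M' f)"
    by (intro prob_space_imp_sigma_finite M.prob_space_distr f)
  show "sets (distr M M' f \<Otimes>\<^sub>M L) = sets (distr (M \<Otimes>\<^sub>M N) (M' \<Otimes>\<^sub>M K) (\<lambda>z. (f (fst z), h z)))"
    by (simp add: sL cong: sets_pair_measure_cong)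
  fix A B assume "A \<in> sets (distr M M' f)" "B \<in> sets L"
  then have [measurable]: "A \<in> sets M'" "B \<in> sets K" by (auto simp: sL)
  have "emeasure (distr (M \<Otimes>\<^sub>M N) (M' \<Otimes>\<^sub>M K) (\<lambda>z. (f (fst z), h z))) (A \<times> B)
      = (\<integral>\<^sup>+z. indicator A (f (fst z)) * indicator B (h z) \<partial>(M \<Otimes>\<^sub>M N))"
    by (subst emeasure_distr_indicator) (auto simp: indicator_times)
  also have "\<dots> = (\<integral>\<^sup>+x. indicator A (f x) * (\<integral>\<^sup>+y. indicator B (h (x, y)) \<partial>N) \<partial>M)"
    by (subst N.nn_integral_fst[symmetric]) (auto intro!: nn_integral_cong nn_integral_cmult)
  also have "\<dots> = (\<integral>\<^sup>+x. indicator A (f x) * emeasure L B \<partial>M)"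
  proof (intro nn_integral_cong)
    fix x assume x: "x \<in> space M"
    have "(\<integral>\<^sup>+y. indicator B (h (x, y)) \<partial>N) = emeasure (distr N K (\<lambda>y. h (x, y))) B"
      using x by (subst emeasure_distr_indicator) auto
    then show "indicator A (f x) * (\<integral>\<^sup>+y. indicator B (h (x, y)) \<partial>N) = indicator A (f x) * emeasure L B"
      by (simp add: L[OF x])
  qed
  also have "\<dots> = emeasure (distr M M' f) A * emeasure L B"
    by (subst nn_integral_multc) (auto simp: emeasure_distr_indicator)
  finally show "emeasure (distr M M' f) A * emeasure L B =
    emeasure (distr (M \<Otimes>\<^sub>M N) (M' \<Otimes>\<^sub>M K) (\<lambda>z. (f (fst z), h z))) (A \<times> B)" by simp
qed

section \<open>Rotation invariance of the standard Gaussian measure\<close>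

text \<open>Stated for any Euclidean space, so that the same measure serves for scalars, for vectors
  and for pairs of vectors.\<close>

definition std_gauss :: "'a::euclidean_space measure" where
  "std_gauss = density lborel (\<lambda>x. ennreal (exp (- (x \<bullet> x) / 2) / sqrt ((2 * pi) ^ DIM('a))))"

lemma sets_std_gauss [simp, measurable_cong]: "sets std_gauss = sets borel"
  and space_std_gauss [simp]: "space std_gauss = UNIV"
  by (simp_all add: std_gauss_def)

lemma std_gauss_real: "std_gauss = density lborel std_normal_density"
  by (simp add: std_gauss_def std_normal_density_def power2_eq_square)

text \<open>Lebesgue measure is the image of a product of one-dimensional ones, and the Gaussian
  density factorises over the coordinates.\<close>

lemma std_gauss_eq_distr_PiM:
  "(std_gauss :: 'a::euclidean_space measure) =
    distr (\<Pi>\<^sub>M b\<in>Basis. density lborel std_normal_density) borel (\<lambda>f. \<Sum>b\<in>Basis. f b *\<^sub>R b)"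
proof -
  let ?T = "\<lambda>f. \<Sum>b\<in>Basis. f b *\<^sub>R b :: 'a"
  let ?g = "\<lambda>x::'a. ennreal (exp (- (x \<bullet> x) / 2) / sqrt ((2 * pi) ^ DIM('a)))"
  have [measurable]: "?T \<in> (\<Pi>\<^sub>M b\<in>Basis. lborel) \<rightarrow>\<^sub>M borel" by measurable
  have "?g (?T f) = (\<Prod>b\<in>Basis. ennreal (std_normal_density (f b)))" for f
  proof -
    have "?T f \<bullet> ?T f = (\<Sum>b\<in>Basis. (f b)\<^sup>2)"
      by (subst euclidean_inner) (simp add: inner_sum_left inner_Basis if_distrib power2_eq_square cong: if_cong)
    then have "exp (- (?T f \<bullet> ?T f) / 2) / sqrt ((2 * pi) ^ DIM('a)) = (\<Prod>b\<in>Basis. std_normal_density (f b))"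
      unfolding real_sqrt_power
      by (simp add: std_normal_density_def prod_dividef exp_sum sum_negf[symmetric] sum_divide_distrib)
    then show ?thesis by (simp add: prod_ennreal)
  qed
  then have "std_gauss = distr (density (\<Pi>\<^sub>M b\<in>Basis. lborel) (\<lambda>f. \<Prod>b\<in>Basis. ennreal (std_normal_density (f b)))) borel ?T"
    unfolding std_gauss_def by (subst lborel_eq, subst density_distr) (simp_all del: real_sqrt_power)
  also have "density (\<Pi>\<^sub>M b\<in>(Basis::'a set). lborel) (\<lambda>f. \<Prod>b\<in>Basis. ennreal (std_normal_density (f b))) =
     (\<Pi>\<^sub>M b\<in>Basis. density lborel std_normal_density)"
    by (subst PiM_density) (auto intro: prob_space_normal_density lborel.sigma_finite_measure_axioms)
  finally show ?thesis .
qed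

lemma prob_space_std_gauss: "prob_space (std_gauss :: 'a::euclidean_space measure)"
proof -
  interpret prob_space "\<Pi>\<^sub>M b\<in>(Basis::'a set). density lborel (\<lambda>x. ennreal (std_normal_density x))"
    by (intro prob_space_PiM prob_space_normal_density) simp
  show ?thesis by (subst std_gauss_eq_distr_PiM) (intro prob_space_distr, measurable)
qed

lemma distr_lborel_shear:
  fixes L :: "'b::euclidean_space \<Rightarrow> 'a::euclidean_space"
  assumes [measurable]: "L \<in> borel_measurable borel"
  shows "distr lborel borel (\<lambda>(x, y). (x + L y, y)) = lborel"
proof (rule measure_eqI)
  fix A :: "('a \<times> 'b) set" assume "A \<in> sets (distr lborel borel (\<lambda>(x, y). (x + L y, y)))"
  then have A [measurable]: "A \<in> sets (borel \<Otimes>\<^sub>M borel)" by (simp only: sets_distr borel_prod)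
  have "emeasure (distr lborel borel (\<lambda>(x, y). (x + L y, y))) A =
     (\<integral>\<^sup>+z. indicator A ((\<lambda>(x, y). (x + L y, y)) z) \<partial>(lborel \<Otimes>\<^sub>M lborel))"
    by (subst emeasure_distr_indicator) (simp_all add: lborel_prod flip: borel_prod)
  also have "\<dots> = (\<integral>\<^sup>+y. \<integral>\<^sup>+x. indicator A (L y + x, y) \<partial>lborel \<partial>lborel)"
    by (subst lborel_pair.nn_integral_snd[symmetric]) (auto simp: add.commute)
  also have "\<dots> = (\<integral>\<^sup>+y. \<integral>\<^sup>+x. indicator A (x, y) \<partial>lborel \<partial>lborel)"
  proof (rule nn_integral_cong)
    fix y
    have "(\<integral>\<^sup>+x. indicator A (x, y) \<partial>lborel) = (\<integral>\<^sup>+x. indicator A (x, y) \<partial>distr lborel borel ((+) (L y)))"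
      by (simp add: lborel_distr_plus)
    also have "\<dots> = (\<integral>\<^sup>+x. indicator A (L y + x, y) \<partial>lborel)"
      by (subst nn_integral_distr) auto
    finally show "(\<integral>\<^sup>+x. indicator A (L y + x, y) \<partial>lborel) = (\<integral>\<^sup>+x. indicator A (x, y) \<partial>lborel)" by (rule sym)
  qed
  also have "\<dots> = emeasure (lborel \<Otimes>\<^sub>M lborel) A"
    by (subst lborel_pair.nn_integral_snd) (auto simp: sets_pair_measure_cong[OF sets_lborel sets_lborel])
  finally show "emeasure (distr lborel borel (\<lambda>(x, y). (x + L y, y))) A = emeasure lborel A"
    by (simp add: lborel_prod)
qed simp

lemma distr_lborel_shear':
  fixes L :: "'a::euclidean_space \<Rightarrow> 'b::euclidean_space"
  assumes [measurable]: "L \<in> borel_measurable borel"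
  shows "distr lborel borel (\<lambda>(x, y). (x, y + L x)) = lborel"
proof (rule measure_eqI)
  fix A :: "('a \<times> 'b) set" assume "A \<in> sets (distr lborel borel (\<lambda>(x, y). (x, y + L x)))"
  then have A [measurable]: "A \<in> sets (borel \<Otimes>\<^sub>M borel)" by (simp only: sets_distr borel_prod)
  have "emeasure (distr lborel borel (\<lambda>(x, y). (x, y + L x))) A =
     (\<integral>\<^sup>+z. indicator A ((\<lambda>(x, y). (x, y + L x)) z) \<partial>(lborel \<Otimes>\<^sub>M lborel))"
    by (subst emeasure_distr_indicator) (simp_all add: lborel_prod flip: borel_prod)
  also have "\<dots> = (\<integral>\<^sup>+x. \<integral>\<^sup>+y. indicator A (x, L x + y) \<partial>lborel \<partial>lborel)"
    by (subst lborel.nn_integral_fst[symmetric]) (auto simp: add.commute)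
  also have "\<dots> = (\<integral>\<^sup>+x. \<integral>\<^sup>+y. indicator A (x, y) \<partial>lborel \<partial>lborel)"
  proof (rule nn_integral_cong)
    fix x
    have "(\<integral>\<^sup>+y. indicator A (x, y) \<partial>lborel) = (\<integral>\<^sup>+y. indicator A (x, y) \<partial>distr lborel borel ((+) (L x)))"
      by (simp add: lborel_distr_plus)
    also have "\<dots> = (\<integral>\<^sup>+y. indicator A (x, L x + y) \<partial>lborel)"
      by (subst nn_integral_distr) auto
    finally show "(\<integral>\<^sup>+y. indicator A (x, L x + y) \<partial>lborel) = (\<integral>\<^sup>+y. indicator A (x, y) \<partial>lborel)" by (rule sym)
  qed
  also have "\<dots> = emeasure (lborel \<Otimes>\<^sub>M lborel) A"
    by (subst lborel.nn_integral_fst) (auto simp: sets_pair_measure_cong[OF sets_lborel sets_lborel])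
  finally show "emeasure (distr lborel borel (\<lambda>(x, y). (x, y + L x))) A = emeasure lborel A"
    by (simp add: lborel_prod)
qed simp

text \<open>The exponents add and the normalising constants multiply. A rotation mixing two
  independent vectors can thus be treated as an isometry of one Gaussian space.\<close>

lemma std_gauss_pair:
  "(std_gauss \<Otimes>\<^sub>M std_gauss :: ('a::euclidean_space \<times> 'b::euclidean_space) measure) = std_gauss"
proof -
  have "exp (- (x \<bullet> x) / 2) / sqrt ((2 * pi) ^ DIM('a)) * (exp (- (y \<bullet> y) / 2) / sqrt ((2 * pi) ^ DIM('b)))
    = exp (- ((x, y) \<bullet> (x, y)) / 2) / sqrt ((2 * pi) ^ DIM('a \<times> 'b))" for x :: 'a and y :: 'b
    by (simp add: exp_add[symmetric] power_add real_sqrt_mult field_simps)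
  moreover have "sigma_finite_measure (std_gauss :: 'b measure)"
    by (intro prob_space_imp_sigma_finite prob_space_std_gauss)
  ultimately show ?thesis
    unfolding std_gauss_def
    by (subst pair_measure_density) (auto simp: lborel.sigma_finite_measure_axioms lborel_prod ennreal_mult'[symmetric] split_beta' simp del: inner_Pair)
qed

text \<open>The density depends on \<open>x\<close> only through \<open>x \<bullet> x\<close>, hence
  is unchanged by \<open>T\<close>.\<close>

lemma distr_std_gauss_isometry:
  fixes T :: "'a::euclidean_space \<Rightarrow> 'a"
  assumes T: "distr lborel borel T = lborel" and norm: "\<And>x. T x \<bullet> T x = x \<bullet> x"
    and [measurable]: "T \<in> borel_measurable borel"
  shows "distr std_gauss borel T = std_gauss"
  unfolding std_gauss_def by (subst (2) T[symmetric], subst density_distr) (simp_all add: norm)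

lemma inner_add_scaleR2:
  "(a + c *\<^sub>R u + d *\<^sub>R w) \<bullet> (a + c *\<^sub>R u + d *\<^sub>R w) = a \<bullet> a + 2 * c * (a \<bullet> u) +
    2 * d * (a \<bullet> w) + c\<^sup>2 * (u \<bullet> u) + 2 * c * d * (u \<bullet> w) + d\<^sup>2 * (w \<bullet> w)"
  by (simp add: inner_add_left inner_add_right inner_commute[of u a] inner_commute[of w a]
      inner_commute[of w u] power2_eq_square distrib_left)

text \<open>For \<open>s \<noteq> -1\<close> a plane rotation is a product of three shears, each of which
  preserves Lebesgue measure by Fubini and translation invariance. With \<open>Q\<close> the identity
  this rotates \<open>(x, y)\<close>; with \<open>Q\<close> a projection only the \<open>Q\<close>-components are rotated.\<close>
lemma std_gauss_rotation:
  fixes Q :: "'a::euclidean_space \<Rightarrow> 'a"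
  assumes Q: "linear Q" "\<And>x. Q (Q x) = Q x" "\<And>x y. Q x \<bullet> y = x \<bullet> Q y"
    and st: "s\<^sup>2 + t\<^sup>2 = 1" "s \<noteq> -1"
  shows "distr (std_gauss \<Otimes>\<^sub>M std_gauss) (borel \<Otimes>\<^sub>M borel)
      (\<lambda>(x, y). (x + (s - 1) *\<^sub>R Q x + t *\<^sub>R Q y, y + (s - 1) *\<^sub>R Q y - t *\<^sub>R Q x)) =
    std_gauss \<Otimes>\<^sub>M std_gauss" (is "distr _ _ ?T = _")
proof -
  note Q_simps = linear_add[OF Q(1)] linear_diff[OF Q(1)] linear_scale[OF Q(1)]
  have [measurable]: "Q \<in> borel_measurable borel"
    by (intro borel_measurable_continuous_onI linear_continuous_on) (simp add: Q linear_conv_bounded_linear[symmetric])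
  \<comment> \<open>For \<open>s = cos \<phi>\<close> and \<open>t = sin \<phi>\<close> this is the
    tangent of half the angle, which makes the outer two shears equal; the denominator is nonzero by
    \<open>s \<noteq> -1\<close>.\<close>
  define k where "k = t / (1 + s)"
  define U where "U = (\<lambda>(x::'a, y). (x + k *\<^sub>R Q y, y))"
  define V where "V = (\<lambda>(x::'a, y). (x, y + (- t) *\<^sub>R Q x))"
  have U [measurable]: "U \<in> borel_measurable borel" and V [measurable]: "V \<in> borel_measurable borel"
    unfolding U_def V_def by (simp_all flip: borel_prod)
  have kt: "t * k = 1 - s" "k * (1 + s) = t"
    using st by (auto simp: k_def field_simps power2_eq_square)
  have UV: "?T = U \<circ> V \<circ> U"
  proof (intro ext, clarify)
    fix x y :: 'a
    have Q1: "Q (x + k *\<^sub>R Q y) = Q x + k *\<^sub>R Q y"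
      by (simp add: Q_simps Q(2))
    have 1: "y + (- t) *\<^sub>R Q (x + k *\<^sub>R Q y) = y + (s - 1) *\<^sub>R Q y - t *\<^sub>R Q x" (is "?y = ?y'")
    proof -
      have "?y = y - (t * k) *\<^sub>R Q y - t *\<^sub>R Q x"
        unfolding Q1 by (simp add: algebra_simps)
      then show ?thesis unfolding kt by (simp add: algebra_simps)
    qed
    have Qy: "Q ?y' = s *\<^sub>R Q y - t *\<^sub>R Q x"
      by (simp add: Q_simps Q(2) algebra_simps)
    have "x + k *\<^sub>R Q y + k *\<^sub>R Q ?y' = x - (t * k) *\<^sub>R Q x + (k * (1 + s)) *\<^sub>R Q y"
      unfolding Qy by (simp add: algebra_simps)
    then have 2: "x + k *\<^sub>R Q y + k *\<^sub>R Q ?y' = x + (s - 1) *\<^sub>R Q x + t *\<^sub>R Q y"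
      unfolding kt by (simp add: algebra_simps)
    show "(x + (s - 1) *\<^sub>R Q x + t *\<^sub>R Q y, ?y') = (U \<circ> V \<circ> U) (x, y)"
      unfolding o_def U_def V_def split 1 2 ..
  qed
  have [measurable]: "?T \<in> borel_measurable borel" unfolding UV by measurable
  have dU: "distr lborel borel U = lborel"
    unfolding U_def by (rule distr_lborel_shear) measurable
  have dV: "distr lborel borel V = lborel"
    unfolding V_def by (rule distr_lborel_shear') measurable
  have "distr lborel borel (U \<circ> V \<circ> U) = distr (distr (distr lborel borel U) borel V) borel U"
    by (simp add: distr_distr comp_assoc)
  then have T: "distr lborel borel ?T = lborel" unfolding UV by (simp only: dU dV)
  have norm: "?T z \<bullet> ?T z = z \<bullet> z" for z
  proof -
    obtain x y where z: "z = (x, y)" by (cases z)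
    have QQ: "a \<bullet> Q b = Q a \<bullet> Q b" for a b using Q(3)[of a "Q b"] by (simp only: Q(2))
    \<comment> \<open>The coefficient of the change in squared norm; it equals
      \<open>s\<^sup>2 + t\<^sup>2 - 1\<close>.\<close>
    have "(s - 1)\<^sup>2 + 2 * (s - 1) + t\<^sup>2 = 0"
      using st(1) by (simp add: power2_eq_square algebra_simps)
    moreover have "(x + (s - 1) *\<^sub>R Q x + t *\<^sub>R Q y) \<bullet> (x + (s - 1) *\<^sub>R Q x + t *\<^sub>R Q y) +
        (y + (s - 1) *\<^sub>R Q y + (- t) *\<^sub>R Q x) \<bullet> (y + (s - 1) *\<^sub>R Q y + (- t) *\<^sub>R Q x) =
        x \<bullet> x + y \<bullet> y + ((s - 1)\<^sup>2 + 2 * (s - 1) + t\<^sup>2) * (Q x \<bullet> Q x + Q y \<bullet> Q y)"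
      unfolding inner_add_scaleR2 QQ[of x y] QQ[of x x] QQ[of y x] QQ[of y y] inner_commute[of "Q y" "Q x"]
      by (simp add: distrib_left distrib_right)
    ultimately show ?thesis by (simp add: z del: inner_add_left inner_add_right)
  qed
  have "distr (std_gauss :: ('a \<times> 'a) measure) borel ?T = std_gauss"
    using T norm by (rule distr_std_gauss_isometry) measurable
  then show ?thesis by (simp add: std_gauss_pair borel_prod)
qed

text \<open>Extracting one unit combination from independent Gaussian vectors costs one degree of
  freedom and leaves an independent remainder. The map \<open>\<tau>\<close> stands for a quadratic
  map whose sum over a pair is invariant under plane rotations; squares and outer products are used
  below. The induction absorbs one vector at a time by rotating it against the combination already
  formed, which avoids completing the weights to an orthogonal matrix.\<close>

lemma std_gauss_sum_residual:
  fixes \<tau> :: "'a::euclidean_space \<Rightarrow> 'b::euclidean_space"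
  assumes \<tau> [measurable]: "\<tau> \<in> borel_measurable borel"
    and rot: "\<And>s t x y. s\<^sup>2 + t\<^sup>2 = 1 \<Longrightarrow> \<tau> (s *\<^sub>R x + t *\<^sub>R y) + \<tau> (s *\<^sub>R y - t *\<^sub>R x) = \<tau> x + \<tau> y"
    and q: "(\<Sum>i<Suc n. (q i)\<^sup>2) = 1"
  shows "distr (\<Pi>\<^sub>M i\<in>{..<Suc n}. std_gauss) (borel \<Otimes>\<^sub>M borel)
      (\<lambda>y. (\<Sum>i<Suc n. q i *\<^sub>R y i, (\<Sum>i<Suc n. \<tau> (y i)) - \<tau> (\<Sum>i<Suc n. q i *\<^sub>R y i))) =
    std_gauss \<Otimes>\<^sub>M distr (\<Pi>\<^sub>M i\<in>{..<n}. std_gauss) borel (\<lambda>y. \<Sum>i<n. \<tau> (y i))"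
  using q
proof (induction n arbitrary: q)
  interpret G: prob_space "std_gauss :: 'a measure" by (rule prob_space_std_gauss)
  interpret PG: product_sigma_finite "\<lambda>_::nat. std_gauss :: 'a measure"
    by (simp add: product_sigma_finite_def G.sigma_finite_measure_axioms)
  have PGn: "prob_space (\<Pi>\<^sub>M i\<in>{..<n}. std_gauss :: 'a measure)" for n :: nat
    by (intro prob_space_PiM prob_space_std_gauss)
  {
    case 0
    have q: "(q 0)\<^sup>2 = 1" using 0 by simp
    \<comment> \<open>A single unit weight is a sign; \<open>t = 0\<close> with equal arguments
      shows that \<open>\<tau>\<close> ignores it, so the residual is zero.\<close>
    have \<tau>q: "\<tau> (q 0 *\<^sub>R x) = \<tau> x" for x
      using rot[of "q 0" 0 x x] q by (simp flip: scaleR_2)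
    have dq: "distr (std_gauss :: 'a measure) borel (\<lambda>x. q 0 *\<^sub>R x) = std_gauss"
    proof -
      have q': "q 0 \<noteq> 0" "\<bar>q 0\<bar> = 1" using q by (auto simp: power2_eq_1_iff)
      have "distr lborel borel (\<lambda>x::'a. q 0 *\<^sub>R x) = lborel"
        by (subst (2) lborel_affine[OF q'(1), of 0]) (simp add: q' density_1)
      moreover have "(q 0 *\<^sub>R x) \<bullet> (q 0 *\<^sub>R x) = x \<bullet> x" for x :: 'a
        using q by (simp add: power2_eq_square flip: mult.assoc)
      ultimately show ?thesis by (rule distr_std_gauss_isometry) measurable
    qed
    show ?case
    proof (rule measure_eqI)
      let ?f = "\<lambda>y. (\<Sum>i<Suc 0. q i *\<^sub>R y i, (\<Sum>i<Suc 0. \<tau> (y i)) - \<tau> (\<Sum>i<Suc 0. q i *\<^sub>R y i))"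
      let ?D = "distr (\<Pi>\<^sub>M i\<in>{..<0::nat}. std_gauss) borel (\<lambda>y. \<Sum>i<0. \<tau> (y i))"
      fix A assume "A \<in> sets (distr (\<Pi>\<^sub>M i\<in>{..<Suc 0::nat}. std_gauss) (borel \<Otimes>\<^sub>M borel) ?f)"
      then have A [measurable]: "A \<in> sets (borel \<Otimes>\<^sub>M borel)" by (simp only: sets_distr)
      let ?F = "indicator A :: _ \<Rightarrow> ennreal"
      have "emeasure (distr (\<Pi>\<^sub>M i\<in>{..<Suc 0::nat}. std_gauss) (borel \<Otimes>\<^sub>M borel) ?f) A =
          (\<integral>\<^sup>+y. ?F (?f y) \<partial>(\<Pi>\<^sub>M i\<in>{..<Suc 0::nat}. std_gauss))"
        by (rule emeasure_distr_indicator) measurable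
      also have "\<dots> = (\<integral>\<^sup>+y. ?F (q 0 *\<^sub>R y 0, 0) \<partial>(\<Pi>\<^sub>M i\<in>{0::nat}. std_gauss))"
        by (simp add: \<tau>q lessThan_Suc)
      also have "\<dots> = (\<integral>\<^sup>+y. ?F (q 0 *\<^sub>R y, 0) \<partial>std_gauss)"
        by (rule PG.product_nn_integral_singleton) measurable
      also have "\<dots> = (\<integral>\<^sup>+y. ?F (y, 0) \<partial>std_gauss)"
        by (subst (2) dq[symmetric], subst nn_integral_distr) auto
      also have "\<dots> = (\<integral>\<^sup>+y. \<integral>\<^sup>+S'. ?F (y, S') \<partial>?D \<partial>std_gauss)"
        by (subst nn_integral_distr) (auto simp: PiM_empty nn_integral_count_space_finite)
      also have "\<dots> = emeasure (std_gauss \<Otimes>\<^sub>M ?D) A"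
      proof -
        have "sigma_finite_measure ?D"
          by (intro prob_space_imp_sigma_finite prob_space.prob_space_distr PGn) measurable
        then show ?thesis
          by (subst nn_integral_indicator[symmetric], simp, subst sigma_finite_measure.nn_integral_fst[symmetric]) auto
      qed
      finally show "emeasure (distr (\<Pi>\<^sub>M i\<in>{..<Suc 0::nat}. std_gauss) (borel \<Otimes>\<^sub>M borel) ?f) A = \<dots>" .
    qed simp
  next
    case (Suc n)
    define s where "s = sqrt (\<Sum>i<Suc n. (q i)\<^sup>2)"
    define t where "t = q (Suc n)"
    have s2: "s\<^sup>2 = (\<Sum>i<Suc n. (q i)\<^sup>2)" unfolding s_def by (simp add: sum_nonneg)
    have "0 \<le> s" unfolding s_def by (simp add: sum_nonneg)
    have st: "s\<^sup>2 + t\<^sup>2 = 1" using Suc.prems by (simp add: s2 t_def)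
    \<comment> \<open>The first \<open>n + 1\<close> weights are normalised by their length
      \<open>s\<close>. If \<open>s = 0\<close> they all vanish and any unit vector serves; the last
      basis vector is taken.\<close>
    obtain q' where q': "(\<Sum>i<Suc n. (q' i)\<^sup>2) = 1" "\<And>i. i < Suc n \<Longrightarrow> q i = s * q' i"
    proof (cases "s = 0")
      case True
      then have "\<And>i. i < Suc n \<Longrightarrow> q i = 0"
        using s2 by (simp add: sum_nonneg_eq_0_iff del: sum.lessThan_Suc)
      moreover have "(\<Sum>i<Suc n. (if i = n then 1 else 0 :: real)\<^sup>2) = 1"
        by (simp add: if_distrib cong: if_cong)
      ultimately show ?thesis using that[of "\<lambda>i. if i = n then 1 else 0"] True by auto
    next
      case False
      then have "(\<Sum>i<Suc n. (q i / s)\<^sup>2) = 1"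
        by (simp add: power_divide s2[symmetric] sum_divide_distrib[symmetric] del: sum.lessThan_Suc)
      then show ?thesis using that[of "\<lambda>i. q i / s"] False by auto
    qed
    define b where "b = (\<lambda>y. \<Sum>i<Suc n. q' i *\<^sub>R y i :: 'a)"
    define S where "S = (\<lambda>y. (\<Sum>i<Suc n. \<tau> (y i)) - \<tau> (b y))"
    define D where "D = distr (\<Pi>\<^sub>M i\<in>{..<n}. std_gauss) borel (\<lambda>y. \<Sum>i<n. \<tau> (y i))"
    let ?G = "\<lambda>n. \<Pi>\<^sub>M i\<in>{..<n}. std_gauss :: 'a measure"
    have [measurable_cong, simp]: "sets D = sets borel" by (simp add: D_def)
    have [simp]: "space D = UNIV" by (simp add: D_def)
    have [measurable]: "b \<in> borel_measurable (?G (Suc n))" "S \<in> borel_measurable (?G (Suc n))"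
      unfolding b_def S_def by measurable
    have D: "prob_space D" unfolding D_def by (intro prob_space.prob_space_distr PGn) measurable
    interpret D: prob_space D by (rule D)
    interpret GD: pair_sigma_finite "std_gauss :: 'a measure" D ..
    interpret GG: pair_sigma_finite "std_gauss :: 'a measure" "std_gauss :: 'a measure" ..
    have IH: "distr (?G (Suc n)) (borel \<Otimes>\<^sub>M borel) (\<lambda>y. (b y, S y)) = std_gauss \<Otimes>\<^sub>M D"
      unfolding b_def S_def D_def using Suc.IH[OF q'(1)] .
    show ?case
    proof (rule measure_eqI)
      let ?f = "\<lambda>y. (\<Sum>i<Suc (Suc n). q i *\<^sub>R y i, (\<Sum>i<Suc (Suc n). \<tau> (y i)) - \<tau> (\<Sum>i<Suc (Suc n). q i *\<^sub>R y i))"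
      fix A assume "A \<in> sets (distr (?G (Suc (Suc n))) (borel \<Otimes>\<^sub>M borel) ?f)"
      then have A [measurable]: "A \<in> sets (borel \<Otimes>\<^sub>M borel)" by (simp only: sets_distr)
      let ?F = "indicator A :: _ \<Rightarrow> ennreal"
      \<comment> \<open>Adding the vector \<open>y\<close> rotates the pair \<open>(b X, y)\<close>:
        the first rotated component is the new combination, and the image of the second under
        \<open>\<tau>\<close> joins the residual.\<close>
      have f: "?f (X(Suc n := y)) = (s *\<^sub>R b X + t *\<^sub>R y, S X + \<tau> (s *\<^sub>R y - t *\<^sub>R b X))" for X y
      proof -
        have "(\<Sum>i<Suc (Suc n). q i *\<^sub>R (X(Suc n := y)) i) = (\<Sum>i<Suc n. q i *\<^sub>R X i) + t *\<^sub>R y"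
          by (subst sum.lessThan_Suc) (auto simp: t_def intro!: sum.cong simp del: sum.lessThan_Suc)
        also have "(\<Sum>i<Suc n. q i *\<^sub>R X i) = s *\<^sub>R b X"
          unfolding b_def scaleR_sum_right by (intro sum.cong) (auto simp: q')
        finally have 1: "(\<Sum>i<Suc (Suc n). q i *\<^sub>R (X(Suc n := y)) i) = s *\<^sub>R b X + t *\<^sub>R y" .
        have "(\<Sum>i<Suc (Suc n). \<tau> ((X(Suc n := y)) i)) = (\<Sum>i<Suc n. \<tau> (X i)) + \<tau> y"
          by (subst sum.lessThan_Suc) (auto intro!: sum.cong simp del: sum.lessThan_Suc)
        also have "\<dots> = S X + \<tau> (s *\<^sub>R b X + t *\<^sub>R y) + \<tau> (s *\<^sub>R y - t *\<^sub>R b X)"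
          using rot[OF st, of "b X" y] by (simp add: S_def algebra_simps)
        finally show ?thesis unfolding 1 by simp
      qed
      \<comment> \<open>With the old residual frozen at \<open>S'\<close>, rotating the independent
        pair is a change of variables; \<open>0 \<le> s\<close> excludes
        \<open>s = -1\<close>.\<close>
      have rotI: "(\<integral>\<^sup>+y. \<integral>\<^sup>+b. ?F (s *\<^sub>R b + t *\<^sub>R y, S' + \<tau> (s *\<^sub>R y - t *\<^sub>R b)) \<partial>std_gauss \<partial>std_gauss) =
          (\<integral>\<^sup>+y. \<integral>\<^sup>+b. ?F (b, S' + \<tau> y) \<partial>std_gauss \<partial>std_gauss)" for S'
      proof -
        have R: "distr (std_gauss \<Otimes>\<^sub>M std_gauss) (borel \<Otimes>\<^sub>M borel)
            (\<lambda>(x, y). (x + (s - 1) *\<^sub>R id x + t *\<^sub>R id y, y + (s - 1) *\<^sub>R id y - t *\<^sub>R id x)) =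
          std_gauss \<Otimes>\<^sub>M (std_gauss :: 'a measure)"
          using st \<open>0 \<le> s\<close> by (intro std_gauss_rotation) (auto intro!: linearI)
        have "(\<integral>\<^sup>+y. \<integral>\<^sup>+b. ?F (b, S' + \<tau> y) \<partial>std_gauss \<partial>std_gauss) =
            (\<integral>\<^sup>+z. ?F (fst z, S' + \<tau> (snd z)) \<partial>(std_gauss \<Otimes>\<^sub>M std_gauss))"
          by (subst GG.nn_integral_snd[symmetric]) auto
        also have "\<dots> = (\<integral>\<^sup>+z. ?F (s *\<^sub>R fst z + t *\<^sub>R snd z, S' + \<tau> (s *\<^sub>R snd z - t *\<^sub>R fst z)) \<partial>(std_gauss \<Otimes>\<^sub>M std_gauss))"
          by (subst R[symmetric], subst nn_integral_distr) (auto simp: split_beta algebra_simps)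
        also have "\<dots> = (\<integral>\<^sup>+y. \<integral>\<^sup>+b. ?F (s *\<^sub>R b + t *\<^sub>R y, S' + \<tau> (s *\<^sub>R y - t *\<^sub>R b)) \<partial>std_gauss \<partial>std_gauss)"
          by (subst GG.nn_integral_snd[symmetric]) auto
        finally show ?thesis ..
      qed
      have "emeasure (distr (?G (Suc (Suc n))) (borel \<Otimes>\<^sub>M borel) ?f) A =
          (\<integral>\<^sup>+y. ?F (?f y) \<partial>?G (Suc (Suc n)))"
        by (rule emeasure_distr_indicator) measurable
      also have "\<dots> = (\<integral>\<^sup>+y. \<integral>\<^sup>+X. ?F (?f (X(Suc n := y))) \<partial>?G (Suc n) \<partial>std_gauss)"
        unfolding lessThan_Suc[of "Suc n"]
        by (rule PG.product_nn_integral_insert_rev) (auto simp flip: lessThan_Suc simp del: sum.lessThan_Suc)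
      also have "\<dots> = (\<integral>\<^sup>+y. \<integral>\<^sup>+z. ?F (s *\<^sub>R fst z + t *\<^sub>R y, snd z + \<tau> (s *\<^sub>R y - t *\<^sub>R fst z))
           \<partial>distr (?G (Suc n)) (borel \<Otimes>\<^sub>M borel) (\<lambda>y. (b y, S y)) \<partial>std_gauss)"
        by (subst nn_integral_distr) (auto simp only: f fst_conv snd_conv, measurable)
      also have "\<dots> = (\<integral>\<^sup>+y. \<integral>\<^sup>+S'. \<integral>\<^sup>+b. ?F (s *\<^sub>R b + t *\<^sub>R y, S' + \<tau> (s *\<^sub>R y - t *\<^sub>R b))
           \<partial>std_gauss \<partial>D \<partial>std_gauss)"
        unfolding IH by (subst GD.nn_integral_snd[symmetric]) auto
      \<comment> \<open>The integrals are reordered to bring the pair \<open>(y, b)\<close>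
        innermost for \<open>rotI\<close>, and afterwards to merge \<open>S'\<close> with
        \<open>\<tau> y\<close> into a sum of \<open>n + 1\<close> terms.\<close>
      also have "\<dots> = (\<integral>\<^sup>+S'. \<integral>\<^sup>+y. \<integral>\<^sup>+b. ?F (s *\<^sub>R b + t *\<^sub>R y, S' + \<tau> (s *\<^sub>R y - t *\<^sub>R b))
           \<partial>std_gauss \<partial>std_gauss \<partial>D)"
        by (rule GD.Fubini'[symmetric]) measurable
      also have "\<dots> = (\<integral>\<^sup>+S'. \<integral>\<^sup>+y. \<integral>\<^sup>+b. ?F (b, S' + \<tau> y) \<partial>std_gauss \<partial>std_gauss \<partial>D)"
        unfolding rotI ..
      also have "\<dots> = (\<integral>\<^sup>+S'. \<integral>\<^sup>+b. \<integral>\<^sup>+y. ?F (b, S' + \<tau> y) \<partial>std_gauss \<partial>std_gauss \<partial>D)"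
        by (intro nn_integral_cong GG.Fubini') measurable
      also have "\<dots> = (\<integral>\<^sup>+b. \<integral>\<^sup>+S'. \<integral>\<^sup>+y. ?F (b, S' + \<tau> y) \<partial>std_gauss \<partial>D \<partial>std_gauss)"
        by (rule GD.Fubini') measurable
      also have "\<dots> = (\<integral>\<^sup>+b. \<integral>\<^sup>+y. \<integral>\<^sup>+S'. ?F (b, S' + \<tau> y) \<partial>D \<partial>std_gauss \<partial>std_gauss)"
        by (intro nn_integral_cong GD.Fubini') measurable
      also have "\<dots> = (\<integral>\<^sup>+b. \<integral>\<^sup>+X. ?F (b, \<Sum>i<Suc n. \<tau> (X i)) \<partial>?G (Suc n) \<partial>std_gauss)"
        unfolding lessThan_Suc[of "n"]
        by (subst PG.product_nn_integral_insert_rev) (auto simp: D_def nn_integral_distr add.commute)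
      also have "\<dots> = emeasure (std_gauss \<Otimes>\<^sub>M distr (?G (Suc n)) borel (\<lambda>y. \<Sum>i<Suc n. \<tau> (y i))) A"
      proof -
        have "sigma_finite_measure (distr (?G (Suc n)) borel (\<lambda>y. \<Sum>i<Suc n. \<tau> (y i)))"
          by (intro prob_space_imp_sigma_finite prob_space.prob_space_distr PGn) measurable
        then show ?thesis
          by (subst nn_integral_indicator[symmetric], simp, subst sigma_finite_measure.nn_integral_fst[symmetric])
            (auto simp: nn_integral_distr simp del: sum.lessThan_Suc)
      qed
      finally show "emeasure (distr (?G (Suc (Suc n))) (borel \<Otimes>\<^sub>M borel) ?f) A = \<dots>" .
    qed simp
  }
qed

section \<open>Chi-squared laws\<close>

text \<open>\<open>noncentral_chisq\<close> is a predicate on laws; equations between measures need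
  the central law as a term.\<close>

definition chisq :: "nat \<Rightarrow> real measure" where
  "chisq k = distr (\<Pi>\<^sub>M i\<in>{..<k}. std_gauss) borel (\<lambda>g. \<Sum>i<k. (g i)\<^sup>2)"

lemma sets_chisq [simp, measurable_cong]: "sets (chisq k) = sets borel"
  and space_chisq [simp]: "space (chisq k) = UNIV"
  by (simp_all add: chisq_def)

lemma prob_space_chisq: "prob_space (chisq k)"
  unfolding chisq_def
  by (intro prob_space.prob_space_distr prob_space_PiM prob_space_std_gauss) measurable

lemma central_chisq_chisq: "central_chisq k (chisq k)"
  unfolding noncentral_chisq_def chisq_def std_gauss_real by (intro exI[of _ "\<lambda>_. 0"]) simp

section \<open>Affine images of the standard Gaussian measure\<close>

lemma distr_std_gauss_affine:
  fixes \<mu> :: "'a::euclidean_space"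
  assumes "0 < \<sigma>"
  shows "distr std_gauss borel (\<lambda>x. \<mu> + \<sigma> *\<^sub>R x) =
    density lborel (\<lambda>x. ennreal (exp (- ((x - \<mu>) \<bullet> (x - \<mu>) / \<sigma>\<^sup>2) / 2) / sqrt ((2 * pi * \<sigma>\<^sup>2) ^ DIM('a))))"
proof -
  let ?T = "\<lambda>x::'a. \<mu> + \<sigma> *\<^sub>R x"
  let ?f = "\<lambda>x. ennreal (exp (- ((x - \<mu>) \<bullet> (x - \<mu>) / \<sigma>\<^sup>2) / 2) / sqrt ((2 * pi * \<sigma>\<^sup>2) ^ DIM('a)))"
  have eq: "ennreal (\<bar>\<sigma>\<bar> ^ DIM('a)) * ?f (?T x) = ennreal (exp (- (x \<bullet> x) / 2) / sqrt ((2 * pi) ^ DIM('a)))" for x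
  proof -
    have "\<sigma> ^ DIM('a) * (exp (- ((?T x - \<mu>) \<bullet> (?T x - \<mu>) / \<sigma>\<^sup>2) / 2) / sqrt ((2 * pi * \<sigma>\<^sup>2) ^ DIM('a))) =
        exp (- (x \<bullet> x) / 2) / sqrt ((2 * pi) ^ DIM('a))"
      unfolding real_sqrt_power real_sqrt_mult power_mult_distrib
      using assms by (simp add: power2_eq_square)
    then show ?thesis using assms by (subst ennreal_mult'[symmetric]) auto
  qed
  have "density lborel ?f = density (density (distr lborel borel ?T) (\<lambda>_. \<bar>\<sigma>\<bar> ^ DIM('a))) ?f"
    using assms by (subst lborel_affine[of \<sigma> \<mu>]) auto
  also have "\<dots> = density (distr lborel borel ?T) (\<lambda>x. ennreal (\<bar>\<sigma>\<bar> ^ DIM('a)) * ?f x)"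
    by (subst density_density_eq) auto
  also have "\<dots> = distr (density lborel (\<lambda>x. ennreal (\<bar>\<sigma>\<bar> ^ DIM('a)) * ?f (?T x))) borel ?T"
    by (subst density_distr) auto
  also have "\<dots> = distr std_gauss borel ?T"
    unfolding eq std_gauss_def ..
  finally show ?thesis ..
qed

lemma distr_std_gauss_translate:
  "distr std_gauss borel (\<lambda>x. a + x) = density lborel (normal_density a 1)" for a :: real
  using distr_std_gauss_affine[of 1 a]
  by (simp add: normal_density_def power2_eq_square)

lemma matrix_mul_scaleR_mat: "(c *\<^sub>R mat 1) ** A = c *\<^sub>R A" for A :: "real^'m^'m"
  by (simp add: vec_eq_iff matrix_matrix_mult_def mat_def if_distrib if_distribR sum.delta'
      cong: if_cong)

lemma matrix_inv_scaleR_mat: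
  assumes "s \<noteq> 0"
  shows "matrix_inv (s *\<^sub>R mat 1 :: real^'m^'m) = (1 / s) *\<^sub>R mat 1"
proof -
  let ?S = "s *\<^sub>R mat 1 :: real^'m^'m"
  have "?S ** ((1 / s) *\<^sub>R mat 1) = mat 1" "((1 / s) *\<^sub>R mat 1) ** ?S = mat 1"
    using assms by (simp_all add: matrix_mul_scaleR_mat)
  then have "?S ** matrix_inv ?S = mat 1"
    unfolding matrix_inv_def by (metis (mono_tags, lifting) someI_ex)
  then have "s *\<^sub>R matrix_inv ?S = mat 1" by (simp add: matrix_mul_scaleR_mat)
  then have "(1 / s) *\<^sub>R (s *\<^sub>R matrix_inv ?S) = (1 / s) *\<^sub>R mat 1" by simp
  then show ?thesis using assms by simp
qed

lemma mvnormal_scalar: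
  fixes \<mu> :: "real^'m"
  assumes "0 < \<sigma>"
  shows "mvnormal \<mu> (\<sigma>\<^sup>2 *\<^sub>R mat 1) = distr std_gauss borel (\<lambda>x. \<mu> + \<sigma> *\<^sub>R x)"
proof -
  have "det (\<sigma>\<^sup>2 *\<^sub>R mat 1 :: real^'m^'m) = (\<sigma>\<^sup>2) ^ CARD('m)"
    by (subst det_diagonal) (auto simp: mat_def)
  then show ?thesis
    using assms
    by (simp add: mvnormal_def distr_std_gauss_affine matrix_inv_scaleR_mat power_mult_distrib
        scaleR_matrix_vector_assoc[symmetric])
qed

section \<open>Splitting Gaussian vectors along a unit direction\<close>

lemma std_gauss_inner_residual:
  fixes v :: "'a::euclidean_space"
  assumes v: "norm v = 1"
  shows "distr std_gauss (borel \<Otimes>\<^sub>M borel) (\<lambda>x. (v \<bullet> x, x \<bullet> x - (v \<bullet> x)\<^sup>2)) =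
    std_gauss \<Otimes>\<^sub>M chisq (DIM('a) - 1)"
proof -
  let ?M = "\<lambda>_. std_gauss :: real measure"
  let ?T = "\<lambda>f. \<Sum>b\<in>Basis. f b *\<^sub>R b :: 'a"
  \<comment> \<open>The coordinates of a Gaussian vector are \<open>DIM('a)\<close> standard normals
    and those of \<open>v\<close> are unit weights, so the residual of the squares has one degree of
    freedom less. The form \<open>Suc n\<close> matches
    \<open>std_gauss_sum_residual\<close>.\<close>
  obtain n where n: "DIM('a) = Suc n" using DIM_positive[where 'a='a] gr0_conv_Suc by blast
  obtain h where h: "bij_betw h {..<Suc n} (Basis :: 'a set)"
    using ex_bij_betw_nat_finite[of "Basis :: 'a set"] by (auto simp: n lessThan_atLeast0)
  define q where "q i = v \<bullet> h i" for i
  have hs: "(\<Sum>b\<in>Basis. F b) = (\<Sum>i<Suc n. F (h i))" for F :: "'a \<Rightarrow> real"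
    using sum.reindex_bij_betw[OF h, of F] by simp
  have q1: "(\<Sum>i<Suc n. (q i)\<^sup>2) = 1"
  proof -
    have "v \<bullet> v = 1" using v by (simp add: norm_eq_1)
    then show ?thesis unfolding q_def euclidean_inner[of v v] hs by (simp add: power2_eq_square)
  qed
  let ?r = "\<lambda>f. \<lambda>i\<in>{..<Suc n}. f (h i)"
  let ?F = "\<lambda>y. (\<Sum>i<Suc n. q i *\<^sub>R y i, (\<Sum>i<Suc n. (y i)\<^sup>2) - (\<Sum>i<Suc n. q i *\<^sub>R y i)\<^sup>2) :: real \<times> real"
  have [measurable]: "?r \<in> PiM Basis ?M \<rightarrow>\<^sub>M PiM {..<Suc n} ?M"
    using bij_betwE[OF h] by (intro measurable_restrict measurable_component_singleton) auto
  have F: "(v \<bullet> ?T f, ?T f \<bullet> ?T f - (v \<bullet> ?T f)\<^sup>2) = ?F (?r f)" for f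
  proof -
    have "v \<bullet> ?T f = (\<Sum>i<Suc n. q i *\<^sub>R ?r f i)"
      unfolding inner_sum_right hs by (simp add: q_def mult.commute)
    moreover have "?T f \<bullet> ?T f = (\<Sum>i<Suc n. (?r f i)\<^sup>2)"
    proof -
      have "?T f \<bullet> ?T f = (\<Sum>b\<in>Basis. (f b)\<^sup>2)"
        by (subst euclidean_inner) (simp add: power2_eq_square)
      then show ?thesis unfolding hs by simp
    qed
    ultimately show ?thesis by (simp only:)
  qed
  have "distr std_gauss (borel \<Otimes>\<^sub>M borel) (\<lambda>x. (v \<bullet> x, x \<bullet> x - (v \<bullet> x)\<^sup>2)) =
     distr (PiM Basis ?M) (borel \<Otimes>\<^sub>M borel) (\<lambda>f. ?F (?r f))"
    by (subst std_gauss_eq_distr_PiM, subst distr_distr)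
      (auto simp: comp_def F std_gauss_real simp del: sum.lessThan_Suc)
  also have "\<dots> = distr (distr (PiM Basis ?M) (PiM {..<Suc n} ?M) ?r) (borel \<Otimes>\<^sub>M borel) ?F"
    by (subst distr_distr) (simp_all add: comp_def del: sum.lessThan_Suc)
  also have "distr (PiM Basis ?M) (PiM {..<Suc n} ?M) ?r = PiM {..<Suc n} ?M"
    using distr_PiM_reindex[of Basis ?M h "{..<Suc n}"] h
    by (auto simp: bij_betw_def prob_space_std_gauss)
  also have "distr (PiM {..<Suc n} ?M) (borel \<Otimes>\<^sub>M borel) ?F =
      std_gauss \<Otimes>\<^sub>M distr (PiM {..<n} ?M) borel (\<lambda>y. \<Sum>i<n. (y i)\<^sup>2)"
  proof (rule std_gauss_sum_residual[OF _ _ q1])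
    fix s t x y :: real assume st: "s\<^sup>2 + t\<^sup>2 = 1"
    have "(s *\<^sub>R x + t *\<^sub>R y)\<^sup>2 + (s *\<^sub>R y - t *\<^sub>R x)\<^sup>2 = (s\<^sup>2 + t\<^sup>2) * (x\<^sup>2 + y\<^sup>2)"
      by (simp add: power2_eq_square algebra_simps)
    then show "(s *\<^sub>R x + t *\<^sub>R y)\<^sup>2 + (s *\<^sub>R y - t *\<^sub>R x)\<^sup>2 = x\<^sup>2 + y\<^sup>2" by (simp add: st)
  qed measurable
  finally show ?thesis by (simp add: chisq_def n)
qed

lemma distr_std_gauss_inner:
  fixes e :: "'a::euclidean_space"
  assumes "norm e = 1"
  shows "distr std_gauss borel (\<lambda>x. e \<bullet> x) = std_gauss"
proof -
  have "distr (distr std_gauss (borel \<Otimes>\<^sub>M borel) (\<lambda>x. (e \<bullet> x, x \<bullet> x - (e \<bullet> x)\<^sup>2))) borel fst =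
      distr (std_gauss \<Otimes>\<^sub>M chisq (DIM('a) - 1)) borel (\<lambda>z. id (fst z))"
    by (simp add: std_gauss_inner_residual[OF assms] id_def)
  also have "\<dots> = distr std_gauss borel id"
    by (rule distr_fst_comp[OF prob_space_chisq]) auto
  also have "\<dots> = std_gauss" by (simp add: distr_id2 id_def)
  finally show ?thesis by (subst (asm) distr_distr) (auto simp: comp_def)
qed

lemma distr_std_gauss_inner_residual:
  fixes v :: "'a::euclidean_space"
  assumes "norm v = 1"
  shows "distr std_gauss borel (\<lambda>x. x \<bullet> x - (v \<bullet> x)\<^sup>2) = chisq (DIM('a) - 1)"
proof -
  have "distr (distr std_gauss (borel \<Otimes>\<^sub>M borel) (\<lambda>x. (v \<bullet> x, x \<bullet> x - (v \<bullet> x)\<^sup>2))) borel snd =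
      distr ((std_gauss :: real measure) \<Otimes>\<^sub>M chisq (DIM('a) - 1)) borel (\<lambda>z. id (snd z))"
    by (simp add: std_gauss_inner_residual[OF assms] id_def)
  also have "\<dots> = distr (chisq (DIM('a) - 1)) borel id"
    by (rule distr_snd_comp[OF prob_space_std_gauss prob_space_chisq]) auto
  also have "\<dots> = chisq (DIM('a) - 1)" by (simp add: distr_id2 id_def)
  finally show ?thesis by (subst (asm) distr_distr) (auto simp: comp_def)
qed

text \<open>A quarter turn (\<open>s = 0\<close>, \<open>t = -1\<close>) restricted to the line
  spanned by \<open>v\<close> exchanges the \<open>v\<close>-components of two independent vectors
  up to sign. Hence a row assembled from two sources is again standard Gaussian.\<close>

lemma distr_std_gauss_exchange:
  fixes v :: "'a::euclidean_space"
  assumes v: "norm v = 1"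
  shows "distr (std_gauss \<Otimes>\<^sub>M std_gauss) borel (\<lambda>z. snd z - (v \<bullet> snd z) *\<^sub>R v + (v \<bullet> fst z) *\<^sub>R v) = std_gauss"
proof -
  have vv: "v \<bullet> v = 1" using v by (simp add: norm_eq_1)
  let ?Q = "\<lambda>x. (v \<bullet> x) *\<^sub>R v"
  have "distr (std_gauss \<Otimes>\<^sub>M std_gauss) (borel \<Otimes>\<^sub>M borel)
      (\<lambda>(x, y). (x + (0 - 1) *\<^sub>R ?Q x + (- 1) *\<^sub>R ?Q y, y + (0 - 1) *\<^sub>R ?Q y - (- 1) *\<^sub>R ?Q x)) =
    std_gauss \<Otimes>\<^sub>M std_gauss"
    by (rule std_gauss_rotation) (auto intro!: linearI simp: vv inner_add_right algebra_simps inner_commute)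
  then have "distr (distr (std_gauss \<Otimes>\<^sub>M std_gauss) (borel \<Otimes>\<^sub>M borel)
      (\<lambda>(x, y). (x + (0 - 1) *\<^sub>R ?Q x + (- 1) *\<^sub>R ?Q y, y + (0 - 1) *\<^sub>R ?Q y - (- 1) *\<^sub>R ?Q x))) borel (\<lambda>z. id (snd z)) =
    distr ((std_gauss :: 'a measure) \<Otimes>\<^sub>M (std_gauss :: 'a measure)) borel (\<lambda>z. id (snd z))" by simp
  also have "\<dots> = distr std_gauss borel id"
    by (rule distr_snd_comp[OF prob_space_std_gauss prob_space_std_gauss]) auto
  also have "\<dots> = std_gauss" by (simp add: distr_id2 id_def)
  finally show ?thesis by (subst (asm) distr_distr) (auto simp: comp_def split_beta)
qed

text \<open>The fallback value \<open>v\<close> keeps this a unit vector when \<open>b\<close> is parallel to \<open>v\<close>, which always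
  happens for \<open>m = 1\<close>; projecting a standard Gaussian vector on it then still gives a standard
  normal variate.\<close>
definition resid_dir :: "'a::euclidean_space \<Rightarrow> 'a \<Rightarrow> 'a" where
  "resid_dir v b = (let p = b - (v \<bullet> b) *\<^sub>R v in if p = 0 then v else p /\<^sub>R norm p)"

lemma norm_resid_dir: "norm v = 1 \<Longrightarrow> norm (resid_dir v b) = 1"
  by (simp add: resid_dir_def Let_def)

lemma measurable_resid_dir [measurable]: "resid_dir v \<in> borel_measurable borel"
  unfolding resid_dir_def Let_def by measurable

lemma outer_prod_mult: "e \<bullet> (outer_prod x x *v e) = (e \<bullet> x)\<^sup>2"
proof -
  have "outer_prod x x *v e = (e \<bullet> x) *\<^sub>R x"
    by (simp add: vec_eq_iff matrix_vector_mult_def outer_prod_def inner_vec_def sum_distrib_left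
        sum_distrib_right mult_ac)
  then show ?thesis by (simp add: power2_eq_square)
qed

lemma matrix_vector_mult_sum: "(\<Sum>i\<in>I. A i) *v x = (\<Sum>i\<in>I. A i *v x)" for A :: "_ \<Rightarrow> real^'m^'k"
  by (induction I rule: infinite_finite_induct) (simp_all add: matrix_vector_mult_add_rdistrib)

lemma measurable_outer_prod [measurable]: "(\<lambda>x. outer_prod x x) \<in> borel_measurable borel"
  unfolding outer_prod_def
  by (intro borel_measurable_continuous_onI continuous_on_vec_lambda continuous_intros)

lemma measurable_quadratic_form [measurable (raw)]:
  fixes e :: "'x \<Rightarrow> real^'m" and S :: "'x \<Rightarrow> real^'m^'m"
  assumes [measurable]: "e \<in> borel_measurable M" "S \<in> borel_measurable M"
  shows "(\<lambda>x. e x \<bullet> (S x *v e x) :: real) \<in> borel_measurable M"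
proof -
  have [measurable]: "(\<lambda>x :: real^'m. x $ i) \<in> borel_measurable borel"
      "(\<lambda>x :: real^'m^'m. x $ i) \<in> borel_measurable borel" for i
    by (intro borel_measurable_continuous_onI linear_continuous_on bounded_linear_vec_nth)+
  show ?thesis unfolding inner_vec_def matrix_vector_mult_def by simp
qed

text \<open>With unit weights \<open>q\<close> fixed, \<open>b\<close> is independent of the
  residual matrix \<open>S\<close> of the outer products, and the first variate depends on
  \<open>b\<close> alone. The second is the quadratic form of \<open>S\<close> in a unit direction
  determined by \<open>b\<close>; its law is the same in every direction, so the two are
  independent.\<close>

lemma distr_direction_residual:
  fixes v :: "real^'m"
  assumes v: "norm v = 1" and n: "0 < n" and q: "(\<Sum>i<n. (q i)\<^sup>2) = 1"
  shows "distr (\<Pi>\<^sub>M i\<in>{..<n}. std_gauss) (borel \<Otimes>\<^sub>M borel)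
     (\<lambda>g. let b = \<Sum>i<n. q i *\<^sub>R g i; e = resid_dir v b
       in (b \<bullet> b - (v \<bullet> b)\<^sup>2, (\<Sum>i<n. (e \<bullet> g i)\<^sup>2) - (e \<bullet> b)\<^sup>2)) =
    chisq (CARD('m) - 1) \<Otimes>\<^sub>M chisq (n - 1)" (is "distr ?G _ ?f = _")
proof -
  obtain k where k: "n = Suc k" using n gr0_conv_Suc by blast
  define D where "D = distr (\<Pi>\<^sub>M i\<in>{..<k}. std_gauss) borel (\<lambda>y. \<Sum>i<k. outer_prod (y i) (y i :: real^'m))"
  have [measurable_cong, simp]: "sets D = sets borel" by (simp add: D_def)
  have PD: "prob_space D" unfolding D_def
    by (intro prob_space.prob_space_distr prob_space_PiM prob_space_std_gauss) measurable
  let ?bS = "\<lambda>y. (\<Sum>i<Suc k. q i *\<^sub>R y i, (\<Sum>i<Suc k. outer_prod (y i) (y i)) -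
     outer_prod (\<Sum>i<Suc k. q i *\<^sub>R y i) (\<Sum>i<Suc k. q i *\<^sub>R y i :: real^'m))"
  let ?Psi = "\<lambda>z. (fst z \<bullet> fst z - (v \<bullet> fst z)\<^sup>2, resid_dir v (fst z) \<bullet> (snd z *v resid_dir v (fst z)))"
  have bS: "distr ?G (borel \<Otimes>\<^sub>M borel) ?bS = std_gauss \<Otimes>\<^sub>M D"
    unfolding D_def k
  proof (rule std_gauss_sum_residual)
    fix s t :: real and x y :: "real^'m" assume st: "s\<^sup>2 + t\<^sup>2 = 1"
    have "outer_prod (s *\<^sub>R x + t *\<^sub>R y) (s *\<^sub>R x + t *\<^sub>R y) + outer_prod (s *\<^sub>R y - t *\<^sub>R x) (s *\<^sub>R y - t *\<^sub>R x) =
       (s\<^sup>2 + t\<^sup>2) *\<^sub>R (outer_prod x x + outer_prod y y)"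
      by (simp add: vec_eq_iff outer_prod_def power2_eq_square algebra_simps)
    then show "outer_prod (s *\<^sub>R x + t *\<^sub>R y) (s *\<^sub>R x + t *\<^sub>R y) + outer_prod (s *\<^sub>R y - t *\<^sub>R x) (s *\<^sub>R y - t *\<^sub>R x) =
       outer_prod x x + outer_prod y y" by (simp add: st)
  qed (use q k in auto)
  have "?f g = ?Psi (?bS g)" for g
    by (simp add: Let_def k matrix_vector_mult_diff_rdistrib matrix_vector_mult_sum inner_diff_right
        inner_sum_right inner_add_right outer_prod_mult matrix_vector_mult_add_rdistrib)
  then have "distr ?G (borel \<Otimes>\<^sub>M borel) ?f = distr (distr ?G (borel \<Otimes>\<^sub>M borel) ?bS) (borel \<Otimes>\<^sub>M borel) ?Psi"
    by (subst distr_distr) (auto simp: comp_def k)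
  also have "\<dots> = distr (std_gauss \<Otimes>\<^sub>M D) (borel \<Otimes>\<^sub>M borel) ?Psi" by (simp only: bS)
  also have "\<dots> = distr std_gauss borel (\<lambda>b. b \<bullet> b - (v \<bullet> b)\<^sup>2) \<Otimes>\<^sub>M chisq (n - 1)"
  proof (rule distr_pair_kernel[OF prob_space_std_gauss PD])
    fix b :: "real^'m"
    let ?e = "resid_dir v b"
    \<comment> \<open>For a fixed unit vector the projections of the rows are independent standard
      normals, whatever \<open>b\<close> is.\<close>
    have "distr D borel (\<lambda>S. ?e \<bullet> (S *v ?e)) =
        distr (\<Pi>\<^sub>M i\<in>{..<k}. std_gauss) borel (\<lambda>y. \<Sum>i<k. (?e \<bullet> y i)\<^sup>2)"
      unfolding D_def
      by (subst distr_distr) (auto simp: comp_def matrix_vector_mult_sum inner_sum_right outer_prod_mult)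
    also have "\<dots> = distr (distr (\<Pi>\<^sub>M i\<in>{..<k}. std_gauss) (\<Pi>\<^sub>M i\<in>{..<k}. borel) (\<lambda>y. \<lambda>i\<in>{..<k}. ?e \<bullet> y i)) borel
        (\<lambda>y. \<Sum>i<k. (y i)\<^sup>2)"
      by (subst distr_distr) (auto simp: comp_def)
    also have "\<dots> = chisq (n - 1)"
      unfolding chisq_def
      by (subst distr_PiM_map) (auto simp: k prob_space_std_gauss distr_std_gauss_inner norm_resid_dir v)
    finally show "distr D borel (\<lambda>y. resid_dir v (fst (b, y)) \<bullet> (snd (b, y) *v resid_dir v (fst (b, y)))) = chisq (n - 1)"
      by simp
  qed measurable
  finally show ?thesis by (simp add: distr_std_gauss_inner_residual[OF v])
qed

section \<open>Perturbation of the largest eigenvalue\<close>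

lemma symmetric_inner_mult:
  fixes A :: "real^'m^'m"
  assumes "transpose A = A"
  shows "x \<bullet> (A *v y) = (A *v x) \<bullet> y"
  using dot_lmul_matrix[of x A y] transpose_matrix_vector[of A x] assms by simp

text \<open>Eigenvectors of different eigenvalues are orthogonal, and nonzero pairwise orthogonal
  vectors are finitely many. Finiteness gives meaning to the \<open>Max\<close> in
  \<open>largest_eigenvalue\<close>.\<close>

lemma finite_eigenvalues_symmetric:
  fixes A :: "real^'m^'m"
  assumes A: "transpose A = A"
  shows "finite {l. \<exists>x. x \<noteq> 0 \<and> A *v x = l *\<^sub>R x}"
proof -
  define E where "E = {l. \<exists>x. x \<noteq> 0 \<and> A *v x = l *\<^sub>R x}"
  have "\<forall>l\<in>E. \<exists>x. x \<noteq> 0 \<and> A *v x = l *\<^sub>R x" by (simp add: E_def)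
  then obtain f where f: "\<And>l. l \<in> E \<Longrightarrow> f l \<noteq> 0" "\<And>l. l \<in> E \<Longrightarrow> A *v f l = l *\<^sub>R f l"
    by metis
  have orth: "f l \<bullet> f l' = 0" if "l \<in> E" "l' \<in> E" "l \<noteq> l'" for l l'
  proof -
    have "l' * (f l \<bullet> f l') = l * (f l \<bullet> f l')"
      using symmetric_inner_mult[OF A, of "f l" "f l'"] f(2)[OF that(1)] f(2)[OF that(2)] by simp
    then show ?thesis using that(3) by simp
  qed
  have "inj_on f E"
  proof (rule inj_onI)
    fix l l' assume l: "l \<in> E" "l' \<in> E" and eq: "f l = f l'"
    then have "f l \<bullet> f l' \<noteq> 0" using f(1)[OF l(2)] by simp
    then show "l = l'" using orth[OF l] by blast
  qed
  moreover have "pairwise orthogonal (f ` E)"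
    by (auto simp: pairwise_def orthogonal_def intro: orth)
  ultimately have "finite E"
    by (intro finite_imageD[OF pairwise_orthogonal_imp_finite])
  then show ?thesis by (simp only: E_def)
qed

text \<open>A maximiser \<open>u\<close> of the quadratic form on the compact unit sphere is an
  eigenvector, since otherwise a small move along \<open>- r\<close> would increase the Rayleigh
  quotient. The maximum dominates every eigenvalue.\<close>

lemma largest_eigenvalue_variational:
  fixes A :: "real^'m^'m"
  assumes A: "transpose A = A"
  obtains u where "norm u = 1" "u \<bullet> (A *v u) = largest_eigenvalue A"
    "\<And>w. w \<bullet> (A *v w) \<le> largest_eigenvalue A * (w \<bullet> w)"
proof -
  have "continuous_on (sphere 0 1) (\<lambda>x. x \<bullet> (A *v x))"
    by (intro continuous_intros linear_continuous_on) (simp add: linear_conv_bounded_linear[symmetric])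
  moreover have "sphere 0 1 \<noteq> ({} :: (real^'m) set)" by simp
  ultimately obtain u where u: "norm u = 1" "\<And>w. norm w = 1 \<Longrightarrow> w \<bullet> (A *v w) \<le> u \<bullet> (A *v u)"
    using continuous_attains_sup[OF compact_sphere, of 0 1 "\<lambda>x. x \<bullet> (A *v x)"] by auto
  define M where "M = u \<bullet> (A *v u)"
  have uu: "u \<bullet> u = 1" using u(1) by (simp add: norm_eq_1)
  have M: "w \<bullet> (A *v w) \<le> M * (w \<bullet> w)" for w
  proof (cases "w = 0")
    case False
    have "(w /\<^sub>R norm w) \<bullet> (A *v (w /\<^sub>R norm w)) \<le> M"
      using False unfolding M_def by (intro u(2)) simp
    then have "(w \<bullet> (A *v w)) / (norm w)\<^sup>2 \<le> M"
      by (simp add: matrix_vector_mult_scaleR power2_eq_square field_simps)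
    then show ?thesis using False by (simp add: power2_norm_eq_inner divide_le_eq)
  qed simp
  define r where "r = M *\<^sub>R u - A *v u"
  define K where "K = M * (r \<bullet> r) - r \<bullet> (A *v r)"
  have K: "0 \<le> K" using M[of r] by (simp add: K_def)
  \<comment> \<open>The slack in the maximality bound at \<open>u + t *\<^sub>R r\<close> is a
    quadratic in \<open>t\<close> that vanishes at \<open>t = 0\<close>.\<close>
  have poly: "0 \<le> 2 * t * (r \<bullet> r) + t\<^sup>2 * K" for t
  proof -
    have "r \<bullet> r = M * (u \<bullet> r) - (A *v u) \<bullet> r" by (subst r_def) (simp add: inner_diff_left)
    then have rr: "(A *v u) \<bullet> r = M * (u \<bullet> r) - r \<bullet> r" by simp
    have "0 \<le> M * ((u + t *\<^sub>R r) \<bullet> (u + t *\<^sub>R r)) - (u + t *\<^sub>R r) \<bullet> (A *v (u + t *\<^sub>R r))"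
      using M[of "u + t *\<^sub>R r"] by simp
    also have "(u + t *\<^sub>R r) \<bullet> (A *v (u + t *\<^sub>R r)) = M + 2 * t * ((A *v u) \<bullet> r) + t\<^sup>2 * (r \<bullet> (A *v r))"
      using symmetric_inner_mult[OF A, of u r]
      by (simp add: matrix_vector_right_distrib matrix_vector_mult_scaleR inner_add_left inner_add_right
          M_def inner_commute power2_eq_square algebra_simps)
    also have "(u + t *\<^sub>R r) \<bullet> (u + t *\<^sub>R r) = 1 + 2 * t * (u \<bullet> r) + t\<^sup>2 * (r \<bullet> r)"
      by (simp add: inner_add_left inner_add_right inner_commute uu power2_eq_square algebra_simps)
    finally show ?thesis unfolding rr K_def by (simp add: algebra_simps)
  qed
  \<comment> \<open>At \<open>t = - c\<close> the quadratic equals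
    \<open>- c\<^sup>2 * (K + 2)\<close>, which forces \<open>c = 0\<close>; the summand 1 keeps the
    denominator positive when \<open>K = 0\<close>.\<close>
  define c where "c = (r \<bullet> r) / (K + 1)"
  have rc: "r \<bullet> r = c * (K + 1)" using K by (simp add: c_def)
  have "c\<^sup>2 * (K + 2) \<le> 0"
    using poly[of "- c"] unfolding rc by (simp add: power2_eq_square algebra_simps)
  then have "c = 0" using K by (simp add: mult_le_0_iff)
  then have "r = 0" using rc by simp
  then have "A *v u = M *\<^sub>R u" by (simp add: r_def)
  then have "M \<in> {l. \<exists>x. x \<noteq> 0 \<and> A *v x = l *\<^sub>R x}" using u(1) by (metis (mono_tags, lifting) mem_Collect_eq norm_zero zero_neq_one)
  moreover have "l \<le> M" if l: "l \<in> {l. \<exists>x. x \<noteq> 0 \<and> A *v x = l *\<^sub>R x}" for l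
  proof -
    obtain x where x: "x \<noteq> 0" "A *v x = l *\<^sub>R x" using l by blast
    then show ?thesis using M[of x] by simp
  qed
  ultimately have "largest_eigenvalue A = M"
    unfolding largest_eigenvalue_def by (intro Max_eqI finite_eigenvalues_symmetric A)
  then show ?thesis using that[of u] u(1) M by (simp add: M_def)
qed

text \<open>By continuity it suffices to test the bound on the quadratic form on a countable dense
  set, so each sublevel set is a countable intersection of measurable sets.\<close>

lemma borel_measurable_largest_eigenvalue:
  fixes S :: "'x \<Rightarrow> real^'m^'m"
  assumes [measurable]: "S \<in> borel_measurable M" and sym: "\<And>x. transpose (S x) = S x"
  shows "(\<lambda>x. largest_eigenvalue (S x)) \<in> borel_measurable M"
  unfolding borel_measurable_iff_le
proof
  fix a :: real
  obtain D :: "(real^'m) set" where D: "countable D" "\<And>X. open X \<Longrightarrow> X \<noteq> {} \<Longrightarrow> \<exists>d\<in>D. d \<in> X"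
    using countable_dense_setE by blast
  have "largest_eigenvalue A \<le> a \<longleftrightarrow> (\<forall>d\<in>D. d \<bullet> (A *v d) \<le> a * (d \<bullet> d))"
    if A: "transpose A = A" for A :: "real^'m^'m"
  proof
    assume "largest_eigenvalue A \<le> a"
    then have "largest_eigenvalue A * (d \<bullet> d) \<le> a * (d \<bullet> d)" for d :: "real^'m"
      by (intro mult_right_mono) auto
    then show "\<forall>d\<in>D. d \<bullet> (A *v d) \<le> a * (d \<bullet> d)"
      using largest_eigenvalue_variational[OF A] by (metis order_trans)
  next
    assume *: "\<forall>d\<in>D. d \<bullet> (A *v d) \<le> a * (d \<bullet> d)"
    obtain u where u: "norm u = 1" "u \<bullet> (A *v u) = largest_eigenvalue A"
      by (rule largest_eigenvalue_variational[OF A])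
    have "open {w. a * (w \<bullet> w) < w \<bullet> (A *v w)}"
      by (intro open_Collect_less continuous_intros linear_continuous_on) (simp add: linear_conv_bounded_linear[symmetric])
    then have "{w. a * (w \<bullet> w) < w \<bullet> (A *v w)} = {}"
    proof (rule contrapos_pp)
      assume "{w. a * (w \<bullet> w) < w \<bullet> (A *v w)} \<noteq> {}"
      then show "\<not> open {w. a * (w \<bullet> w) < w \<bullet> (A *v w)}"
        using D(2)[of "{w. a * (w \<bullet> w) < w \<bullet> (A *v w)}"] * by force
    qed
    then have "u \<bullet> (A *v u) \<le> a * (u \<bullet> u)" by (auto simp: not_less)
    moreover have "u \<bullet> u = 1" using u(1) by (simp add: norm_eq_1)
    ultimately show "largest_eigenvalue A \<le> a" using u(2) by simp
  qed
  then have "{w \<in> space M. largest_eigenvalue (S w) \<le> a} =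
      {w \<in> space M. \<forall>d\<in>D. d \<bullet> (S w *v d) \<le> a * (d \<bullet> d)}"
    by (simp only: sym)
  also have "\<dots> \<in> sets M"
    using D(1) by measurable
  finally show "{w \<in> space M. largest_eigenvalue (S w) \<le> a} \<in> sets M" .
qed

section \<open>Gram matrices with a dominant direction\<close>

lemma transpose_gram: "transpose (gram n z) = gram n z"
  by (simp add: gram_def transpose_def vec_eq_iff outer_prod_def mult.commute)

lemma gram_quadratic_form: "w \<bullet> (gram n z *v w) = (\<Sum>i<n. (w \<bullet> z i)\<^sup>2)"
  by (simp add: gram_def matrix_vector_mult_sum inner_sum_right outer_prod_mult)

text \<open>Cauchy-Schwarz with two weights whose reciprocals sum to 1; the gap is a multiple of a
  perfect square. In the application the second weight cancels a factor \<open>T\<close>.\<close>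

lemma sum_square_weighted_le:
  fixes \<alpha> \<beta> d T :: real
  assumes "0 < T" "T < d"
  shows "(\<alpha> + \<beta>)\<^sup>2 \<le> d / (d - T) * \<alpha>\<^sup>2 + d / T * \<beta>\<^sup>2"
proof -
  have "d / (d - T) * \<alpha>\<^sup>2 + d / T * \<beta>\<^sup>2 - (\<alpha> + \<beta>)\<^sup>2 = (T * \<alpha> - (d - T) * \<beta>)\<^sup>2 / (T * (d - T))"
    using assms by (simp add: field_simps power2_eq_square)
  also have "\<dots> \<ge> 0" using assms by simp
  finally show ?thesis by simp
qed

text \<open>With \<open>k = \<Sum> q\<^sub>i z\<^sub>i\<close> and \<open>t\<^sub>i = z\<^sub>i - q\<^sub>i k\<close> one has \<open>\<Sum> q\<^sub>i t\<^sub>i = 0\<close>, so the Gram form splits as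
  \<open>(w \<bullet> k)\<^sup>2 + \<Sum> (w \<bullet> t\<^sub>i)\<^sup>2\<close>: a large rank-one form plus a small one. The direction \<open>k\<close> gives
  the lower bound and the weighted square inequality the upper bound.\<close>
lemma top_singular_value_perturbation:
  fixes z :: "nat \<Rightarrow> 'a::real_inner" and v :: 'a
  assumes v: "norm v = 1"
    and a: "(\<Sum>i<n. (v \<bullet> z i)\<^sup>2) = a" "0 < a"
    and q: "\<And>i. i < n \<Longrightarrow> v \<bullet> z i = q i * sqrt a"
    and bb: "(\<Sum>i<n. q i *\<^sub>R z i) = sqrt a *\<^sub>R v + bb"
    and W: "(\<Sum>i<n. (bb \<bullet> (z i - q i *\<^sub>R (sqrt a *\<^sub>R v + bb)))\<^sup>2) = W"
    and Y: "(\<Sum>i<n. (norm (z i - (v \<bullet> z i) *\<^sub>R v))\<^sup>2) = Y" "2 * Y \<le> a"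
    and u: "norm u = 1" "(\<Sum>i<n. (u \<bullet> z i)\<^sup>2) = l" "\<And>w. (\<Sum>i<n. (w \<bullet> z i)\<^sup>2) \<le> l * (w \<bullet> w)"
  shows "\<bar>l - (a + (norm bb)\<^sup>2 + W / a)\<bar> \<le> 2 * Y ^ 3 / a\<^sup>2"
proof -
  have vv: "v \<bullet> v = 1" using v by (simp add: norm_eq_1)
  define k where "k = sqrt a *\<^sub>R v + bb"
  define t where "t i = z i - q i *\<^sub>R k" for i
  define T where "T = (\<Sum>i<n. (norm (t i))\<^sup>2)"
  define d where "d = a + (norm bb)\<^sup>2"
  have sa: "sqrt a * sqrt a = a" "0 < sqrt a" using a(2) by auto
  have "a * (\<Sum>i<n. (q i)\<^sup>2) = a"
  proof -
    have "a * (\<Sum>i<n. (q i)\<^sup>2) = (\<Sum>i<n. (v \<bullet> z i)\<^sup>2)"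
      unfolding sum_distrib_left using a(2) by (intro sum.cong) (auto simp: q power_mult_distrib)
    then show ?thesis using a(1) by simp
  qed
  then have q1: "(\<Sum>i<n. (q i)\<^sup>2) = 1" using a(2) by simp
  have vbb: "v \<bullet> bb = 0"
  proof -
    have "v \<bullet> (\<Sum>i<n. q i *\<^sub>R z i) = (\<Sum>i<n. (q i)\<^sup>2 * sqrt a)"
      unfolding inner_sum_right by (intro sum.cong) (auto simp: q power2_eq_square)
    also have "\<dots> = sqrt a" by (simp add: sum_distrib_right[symmetric] q1)
    finally show ?thesis unfolding bb by (simp add: inner_add_right vv)
  qed
  have kk: "k \<bullet> k = d"
    using a(2) by (simp add: k_def d_def inner_add_left inner_add_right vv vbb inner_commute[of bb v]
        power2_norm_eq_inner flip: mult.assoc)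
  have d: "0 < d" "a \<le> d" using a(2) by (auto simp: d_def add_pos_nonneg)
  have qz: "(\<Sum>i<n. q i * (w \<bullet> z i)) = w \<bullet> k" for w
    using bb by (simp add: k_def inner_sum_right flip: bb)
  have split: "(\<Sum>i<n. (w \<bullet> z i)\<^sup>2) = (w \<bullet> k)\<^sup>2 + (\<Sum>i<n. (w \<bullet> t i)\<^sup>2)" for w
  proof -
    have "(\<Sum>i<n. (w \<bullet> t i)\<^sup>2) = (\<Sum>i<n. (w \<bullet> z i)\<^sup>2) - 2 * (w \<bullet> k) * (\<Sum>i<n. q i * (w \<bullet> z i)) + (w \<bullet> k)\<^sup>2 * (\<Sum>i<n. (q i)\<^sup>2)"
      by (simp add: t_def inner_diff_right power2_diff power_mult_distrib sum.distrib sum_subtractf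
          sum_distrib_left algebra_simps)
    then show ?thesis unfolding qz q1 by (simp add: power2_eq_square)
  qed
  have vt: "v \<bullet> t i = 0" if "i < n" for i
    using that by (simp add: t_def k_def inner_diff_right inner_add_right vv vbb q)
  have W': "(\<Sum>i<n. (k \<bullet> t i)\<^sup>2) = W"
    unfolding W[symmetric]
  proof (intro sum.cong refl)
    fix i assume "i \<in> {..<n}"
    then have "k \<bullet> t i = bb \<bullet> t i" using vt[of i] by (simp add: k_def inner_add_left)
    then show "(k \<bullet> t i)\<^sup>2 = (bb \<bullet> (z i - q i *\<^sub>R (sqrt a *\<^sub>R v + bb)))\<^sup>2" by (simp add: t_def k_def)
  qed
  have W0: "0 \<le> W" unfolding W'[symmetric] by (simp add: sum_nonneg)
  have T0: "0 \<le> T" unfolding T_def by (simp add: sum_nonneg)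
  \<comment> \<open>The part of \<open>z i\<close> orthogonal to \<open>v\<close> is
    \<open>t i + q i *\<^sub>R bb\<close>; the cross terms cancel because the weighted sum of the
    \<open>t i\<close> is zero.\<close>
  have YT: "Y = T + (norm bb)\<^sup>2"
  proof -
    have "Y = (\<Sum>i<n. (norm (t i + q i *\<^sub>R bb))\<^sup>2)"
      unfolding Y(1)[symmetric]
      by (intro sum.cong arg_cong[where f="\<lambda>x. (norm x)\<^sup>2"] refl)
        (simp add: t_def k_def q scaleR_add_right)
    also have "\<dots> = (\<Sum>i<n. (norm (t i))\<^sup>2) + 2 * (\<Sum>i<n. q i * (bb \<bullet> t i)) + (norm bb)\<^sup>2 * (\<Sum>i<n. (q i)\<^sup>2)"
    proof -
      have "(norm (t i + q i *\<^sub>R bb))\<^sup>2 = (norm (t i))\<^sup>2 + 2 * (q i * (bb \<bullet> t i)) + (norm bb)\<^sup>2 * (q i)\<^sup>2" for i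
        unfolding power2_norm_eq_inner
        by (simp add: inner_add_left inner_add_right inner_commute[of bb "t i"] power2_eq_square algebra_simps)
      then show ?thesis by (simp add: sum.distrib sum_distrib_left)
    qed
    also have "(\<Sum>i<n. q i * (bb \<bullet> t i)) = 0"
    proof -
      have "(\<Sum>i<n. q i * (bb \<bullet> t i)) = (\<Sum>i<n. q i * (bb \<bullet> z i)) - (\<Sum>i<n. (q i)\<^sup>2) * (bb \<bullet> k)"
        by (simp add: t_def inner_diff_right right_diff_distrib sum_subtractf sum_distrib_right power2_eq_square mult.assoc)
      then show ?thesis by (simp add: qz q1)
    qed
    finally show ?thesis by (simp add: T_def q1)
  qed
  then have YT': "T \<le> Y" "(norm bb)\<^sup>2 \<le> Y" "0 \<le> Y" using T0 by auto
  have CS: "(\<Sum>i<n. (w \<bullet> t i)\<^sup>2) \<le> (norm w)\<^sup>2 * T" for w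
    unfolding T_def sum_distrib_left
    by (intro sum_mono) (metis Cauchy_Schwarz_ineq power2_norm_eq_inner)
  have WY: "W \<le> Y * Y"
  proof -
    have "W \<le> (norm bb)\<^sup>2 * T"
      using CS[of bb] W by (simp add: t_def k_def)
    also have "\<dots> \<le> Y * Y" using YT' T0 by (intro mult_mono) auto
    finally show ?thesis .
  qed
  have lower: "d + W / d \<le> l"
  proof -
    have "d\<^sup>2 + W \<le> l * d" using u(3)[of k] split[of k] by (simp add: kk W')
    then show ?thesis using d by (simp add: field_simps power2_eq_square)
  qed
  have Td: "2 * T \<le> d" using YT'(1) Y(2) d by simp
  have upper: "l \<le> d + W / (d - T)"
  proof -
    \<comment> \<open>\<open>u\<close> is split into its component along \<open>k\<close> and a rest
      \<open>r\<close> orthogonal to \<open>k\<close>.\<close>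
    define p where "p = (u \<bullet> k) / d"
    define r where "r = u - p *\<^sub>R k"
    have pk: "u \<bullet> k = p * d" using d by (simp add: p_def)
    have uu: "u \<bullet> u = 1" using u(1) by (simp add: norm_eq_1)
    have "r \<bullet> r = u \<bullet> u - 2 * p * (u \<bullet> k) + p\<^sup>2 * (k \<bullet> k)"
      by (simp add: r_def inner_diff_left inner_diff_right inner_commute power2_eq_square algebra_simps)
    then have r: "(norm r)\<^sup>2 = 1 - p\<^sup>2 * d"
      unfolding power2_norm_eq_inner[of r] by (simp add: kk pk uu power2_eq_square algebra_simps)
    then have pd: "p\<^sup>2 * d \<le> 1" using zero_le_power2[of "norm r"] by linarith
    show ?thesis
    proof (cases "T = 0")
      case True
      have "(\<Sum>i<n. (u \<bullet> t i)\<^sup>2) \<le> 0" using CS[of u] True by simp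
      then have "l \<le> (p * d)\<^sup>2" using split[of u] u(2) pk by simp
      also have "\<dots> = (p\<^sup>2 * d) * d" by (simp add: power2_eq_square)
      also have "\<dots> \<le> 1 * d" using pd d by (intro mult_right_mono) auto
      also have "\<dots> \<le> d + W / (d - T)" using W0 d True by simp
      finally show ?thesis .
    next
      case False
      then have T: "0 < T" "T < d" using T0 Td d by auto
      have "(\<Sum>i<n. (u \<bullet> t i)\<^sup>2) \<le> (\<Sum>i<n. d / (d - T) * (p * (k \<bullet> t i))\<^sup>2 + d / T * (r \<bullet> t i)\<^sup>2)"
      proof (intro sum_mono)
        fix i
        have "u \<bullet> t i = p * (k \<bullet> t i) + r \<bullet> t i" by (simp add: r_def inner_diff_left)
        then show "(u \<bullet> t i)\<^sup>2 \<le> d / (d - T) * (p * (k \<bullet> t i))\<^sup>2 + d / T * (r \<bullet> t i)\<^sup>2"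
          using sum_square_weighted_le[OF T] by simp
      qed
      also have "\<dots> = d / (d - T) * p\<^sup>2 * (\<Sum>i<n. (k \<bullet> t i)\<^sup>2) + d / T * (\<Sum>i<n. (r \<bullet> t i)\<^sup>2)"
        by (simp add: sum.distrib sum_distrib_left power_mult_distrib mult.assoc)
      \<comment> \<open>The factor \<open>T\<close> from Cauchy-Schwarz cancels
        \<open>d / T\<close>, leaving \<open>d\<close> times the squared norm of \<open>r\<close>,
        which is exactly what \<open>(u \<bullet> k)\<^sup>2\<close> falls short of
        \<open>d\<close>.\<close>
      also have "\<dots> \<le> d / (d - T) * p\<^sup>2 * W + d / T * ((norm r)\<^sup>2 * T)"
        unfolding W' using T by (intro add_left_mono mult_left_mono CS) auto
      also have "\<dots> = (p\<^sup>2 * d) * (W / (d - T)) + d * (1 - p\<^sup>2 * d)"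
        using T by (simp add: r)
      also have "\<dots> \<le> 1 * (W / (d - T)) + d * (1 - p\<^sup>2 * d)"
        using pd W0 T by (intro add_right_mono mult_right_mono) auto
      finally have "l \<le> (p * d)\<^sup>2 + W / (d - T) + d * (1 - p\<^sup>2 * d)"
        using split[of u] u(2) pk by simp
      then show ?thesis by (simp add: power2_eq_square algebra_simps)
    qed
  qed
  \<comment> \<open>\<open>W / d\<close> is compared with \<open>W / a\<close> and with
    \<open>W / (d - T)\<close>. The errors are cubic in \<open>Y\<close> because
    \<open>W \<le> Y * Y\<close> and both \<open>d - a\<close> and \<open>T\<close> are at most
    \<open>Y\<close>, while \<open>2 * Y \<le> a\<close> gives
    \<open>d - T \<ge> a / 2\<close>.\<close>
  have "W / a - W / d = W * (norm bb)\<^sup>2 / (a * d)"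
    using a(2) d by (simp add: d_def field_simps)
  also have "\<dots> \<le> (Y * Y) * Y / (a * a)"
    using a(2) d YT' WY W0 by (intro frac_le mult_mono) auto
  finally have 1: "W / a - W / d \<le> Y ^ 3 / a\<^sup>2" by (simp add: power2_eq_square power3_eq_cube)
  have "W / (d - T) - W / d = W * T / ((d - T) * d)"
    using d Td T0 by (simp add: field_simps)
  also have "\<dots> \<le> (Y * Y) * Y / ((a / 2) * a)"
    using a(2) d YT' WY W0 T0 Td Y by (intro frac_le mult_mono) auto
  finally have 2: "W / (d - T) - W / d \<le> 2 * Y ^ 3 / a\<^sup>2" by (simp add: power2_eq_square power3_eq_cube mult_ac)
  have 3: "W / d \<le> W / a" using a(2) d W0 by (intro divide_left_mono) auto
  have 4: "0 \<le> Y ^ 3 / a\<^sup>2" using YT' by simp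
  show ?thesis using lower upper 1 2 3 4 unfolding d_def by (simp add: abs_le_iff)
qed

text \<open>Along any positive null sequence the indicators of the exceptional events tend to 0
  pointwise, and dominated convergence on the fixed space makes their probabilities vanish.\<close>

lemma small_op_pointwise:
  assumes M: "prob_space M" and [measurable]: "\<And>s. 0 < s \<Longrightarrow> R s \<in> borel_measurable M"
    and lim: "\<And>x. x \<in> space M \<Longrightarrow> ((\<lambda>s. R s x / r s) \<longlongrightarrow> 0) (at_right 0)"
  shows "small_op (\<lambda>_. M) R r (at_right (0::real))"
  unfolding small_op_def
proof (intro allI impI tendsto_at_right_sequentially[of 0 1])
  interpret prob_space M by fact
  fix \<epsilon> :: real and S :: "nat \<Rightarrow> real"
  assume eps: "0 < \<epsilon>" and S: "\<And>n. 0 < S n" "S \<longlonglongrightarrow> 0"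
  note [measurable] = assms(2)[OF S(1)]
  let ?E = "\<lambda>n. {x \<in> space M. \<epsilon> < \<bar>R (S n) x / r (S n)\<bar>}"
  have "(\<lambda>n. \<integral>x. indicat_real (?E n) x \<partial>M) \<longlonglongrightarrow> (\<integral>x. 0 \<partial>M)"
  proof (rule integral_dominated_convergence[where w="\<lambda>_. 1"])
    show "AE x in M. (\<lambda>n. indicat_real (?E n) x) \<longlonglongrightarrow> 0"
    proof (rule AE_I2)
      fix x assume x: "x \<in> space M"
      have "filterlim S (at_right 0) sequentially"
        using S(2) less_imp_neq[OF S(1), symmetric] S(1) by (simp add: filterlim_at)
      then have "(\<lambda>n. R (S n) x / r (S n)) \<longlonglongrightarrow> 0"
        using lim[OF x] filterlim_compose by blast
      then have "eventually (\<lambda>n. \<bar>R (S n) x / r (S n)\<bar> < \<epsilon>) sequentially"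
        using eps by (auto simp: tendsto_iff dist_real_def)
      then have "eventually (\<lambda>n. indicat_real (?E n) x = 0) sequentially"
        by eventually_elim auto
      then show "(\<lambda>n. indicat_real (?E n) x) \<longlonglongrightarrow> 0" by (rule tendsto_eventually)
    qed
  qed (auto simp: indicator_def)
  then show "(\<lambda>n. measure M (?E n)) \<longlonglongrightarrow> 0" by simp
qed simp

section \<open>The stochastic representation\<close>

text \<open>Evaluating the product law on boxes gives everything: two factors \<open>UNIV\<close>
  yield a marginal law, general boxes yield independence. The list indexing is that of the final
  statement.\<close>

lemma indep_vars3_of_distr:
  fixes A B C :: "'w \<Rightarrow> real"
  assumes M: "prob_space M" and [measurable]: "A \<in> borel_measurable M" "B \<in> borel_measurable M" "C \<in> borel_measurable M"
    and L: "prob_space LA" "prob_space LB" "prob_space LC" 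
    and sL [simp, measurable_cong]: "sets LA = sets borel" "sets LB = sets borel" "sets LC = sets borel"
    and D: "distr M (borel \<Otimes>\<^sub>M (borel \<Otimes>\<^sub>M borel)) (\<lambda>x. (A x, B x, C x)) = LA \<Otimes>\<^sub>M (LB \<Otimes>\<^sub>M LC)"
  shows "distr M borel A = LA" "distr M borel B = LB" "distr M borel C = LC"
    "prob_space.indep_vars M (\<lambda>_. borel) (\<lambda>i. [A, B, C] ! i) {..<3}"
proof -
  interpret M: prob_space M by fact
  interpret LA: prob_space LA by fact
  interpret LB: prob_space LB by fact
  interpret LC: prob_space LC by fact
  interpret LBC: pair_prob_space LB LC ..
  have [simp]: "space LA = UNIV" "space LB = UNIV" "space LC = UNIV"
    using sL[THEN sets_eq_imp_space_eq] by auto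
  have box: "emeasure M {x \<in> space M. A x \<in> X \<and> B x \<in> Y \<and> C x \<in> Z} = emeasure LA X * (emeasure LB Y * emeasure LC Z)"
    if [measurable]: "X \<in> sets borel" "Y \<in> sets borel" "Z \<in> sets borel" for X Y Z
  proof -
    have "{x \<in> space M. A x \<in> X \<and> B x \<in> Y \<and> C x \<in> Z} = (\<lambda>x. (A x, B x, C x)) -` (X \<times> Y \<times> Z) \<inter> space M"
      by auto
    then have "emeasure M {x \<in> space M. A x \<in> X \<and> B x \<in> Y \<and> C x \<in> Z} =
        emeasure (distr M (borel \<Otimes>\<^sub>M (borel \<Otimes>\<^sub>M borel)) (\<lambda>x. (A x, B x, C x))) (X \<times> Y \<times> Z)"
      by (subst emeasure_distr) auto
    also have "\<dots> = emeasure LA X * (emeasure LB Y * emeasure LC Z)"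
      unfolding D using that
      by (subst LBC.P.emeasure_pair_measure_Times) (auto simp: LC.emeasure_pair_measure_Times)
    finally show ?thesis .
  qed
  have one: "emeasure LA UNIV = 1" "emeasure LB UNIV = 1" "emeasure LC UNIV = 1"
    using LA.emeasure_space_1 LB.emeasure_space_1 LC.emeasure_space_1 by auto
  show A: "distr M borel A = LA"
  proof (rule measure_eqI)
    fix X assume "X \<in> sets (distr M borel A)"
    then show "emeasure (distr M borel A) X = emeasure LA X"
      using box[of X UNIV UNIV] by (auto simp: emeasure_distr one vimage_def Int_def conj_commute)
  qed simp
  show B: "distr M borel B = LB"
  proof (rule measure_eqI)
    fix X assume "X \<in> sets (distr M borel B)"
    then show "emeasure (distr M borel B) X = emeasure LB X"
      using box[of UNIV X UNIV] by (auto simp: emeasure_distr one vimage_def Int_def conj_commute)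
  qed simp
  show C: "distr M borel C = LC"
  proof (rule measure_eqI)
    fix X assume "X \<in> sets (distr M borel C)"
    then show "emeasure (distr M borel C) X = emeasure LC X"
      using box[of UNIV UNIV X] by (auto simp: emeasure_distr one vimage_def Int_def conj_commute)
  qed simp
  have I: "{..<3} = {0, 1, 2::nat}" by auto
  show "M.indep_vars (\<lambda>_. borel) (\<lambda>i. [A, B, C] ! i) {..<3}"
  proof (subst M.indep_vars_finite[where E="\<lambda>_. sets borel"])
    show "\<forall>X\<in>{..<3} \<rightarrow> sets borel. M.prob (\<Inter>j\<in>{..<3}. ([A, B, C] ! j) -` X j \<inter> space M) =
        (\<Prod>j\<in>{..<3}. M.prob (([A, B, C] ! j) -` X j \<inter> space M))"
    proof
      fix X :: "nat \<Rightarrow> real set" assume "X \<in> {..<3} \<rightarrow> sets borel"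
      then have X [measurable]: "X 0 \<in> sets borel" "X 1 \<in> sets borel" "X 2 \<in> sets borel" by auto
      have "(\<Inter>j\<in>{..<3}. ([A, B, C] ! j) -` X j \<inter> space M) = {x \<in> space M. A x \<in> X 0 \<and> B x \<in> X 1 \<and> C x \<in> X 2}"
        unfolding I by auto
      then have "M.prob (\<Inter>j\<in>{..<3}. ([A, B, C] ! j) -` X j \<inter> space M) =
          measure LA (X 0) * (measure LB (X 1) * measure LC (X 2))"
        using box[OF X] by (simp add: measure_def enn2real_mult)
      also have "\<dots> = (\<Prod>j\<in>{..<3}. M.prob (([A, B, C] ! j) -` X j \<inter> space M))"
      proof -
        have "measure LA (X 0) = M.prob (A -` X 0 \<inter> space M)" "measure LB (X 1) = M.prob (B -` X 1 \<inter> space M)"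
          "measure LC (X 2) = M.prob (C -` X 2 \<inter> space M)"
          unfolding A[symmetric] B[symmetric] C[symmetric] by (simp_all only: measure_distr assms X)
        then show ?thesis unfolding I by simp
      qed
      finally show "M.prob (\<Inter>j\<in>{..<3}. ([A, B, C] ! j) -` X j \<inter> space M) =
          (\<Prod>j\<in>{..<3}. M.prob (([A, B, C] ! j) -` X j \<inter> space M))" .
    qed
    fix i :: nat assume "i \<in> {..<3}"
    then show "M.random_variable borel ([A, B, C] ! i)" unfolding I by auto
    show "sets borel = sigma_sets (space borel) (sets borel)" by (metis sets.sigma_sets_eq)
    show "Int_stable (sets borel)" by (rule sets.Int_stable)
  qed (auto simp: I)
qed

text \<open>The quadratic form of the Gram matrix vanishes on vectors orthogonal to
  \<open>v\<close>, so no mean can have a component there.\<close>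

lemma rank_one_means:
  fixes v :: "real^'m"
  assumes v: "norm v = 1" and g: "gram n \<mu> = \<omega> *\<^sub>R outer_prod v v"
  shows "(\<Sum>i<n. (v \<bullet> \<mu> i)\<^sup>2) = \<omega>" "i < n \<Longrightarrow> \<mu> i = (v \<bullet> \<mu> i) *\<^sub>R v"
proof -
  have vv: "v \<bullet> v = 1" using v by (simp add: norm_eq_1)
  have q: "(\<Sum>i<n. (w \<bullet> \<mu> i)\<^sup>2) = \<omega> * (w \<bullet> v)\<^sup>2" for w
    using gram_quadratic_form[of w n \<mu>] unfolding g
    by (simp add: scaleR_matrix_vector_assoc[symmetric] outer_prod_mult)
  show "(\<Sum>i<n. (v \<bullet> \<mu> i)\<^sup>2) = \<omega>" using q[of v] by (simp add: vv)
  assume i: "i < n"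
  define w where "w = \<mu> i - (v \<bullet> \<mu> i) *\<^sub>R v"
  have wv: "w \<bullet> v = 0" by (simp add: w_def inner_diff_left vv inner_commute[of "\<mu> i" v])
  have "(\<Sum>i<n. (w \<bullet> \<mu> i)\<^sup>2) = 0" using q[of w] by (simp add: wv)
  then have "w \<bullet> \<mu> i = 0" using i by (simp add: sum_nonneg_eq_0_iff)
  then have "w \<bullet> w = 0" using wv by (subst (2) w_def) (simp add: inner_diff_right)
  then show "\<mu> i = (v \<bullet> \<mu> i) *\<^sub>R v" by (simp add: w_def)
qed

text \<open>Multiplying the noncentrality matrix by \<open>\<sigma>\<^sup>2\<close> recovers the
  Gram matrix of the means, so they are multiples of \<open>v\<close>. The coefficients come from an
  arbitrary witness and may change with \<open>\<sigma>\<close>.\<close>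

lemma wishart_rank_one_means:
  fixes v :: "real^'m"
  assumes v: "norm v = 1" and s: "0 < \<sigma>"
    and W: "noncentral_wishart n (\<sigma>\<^sup>2 *\<^sub>R mat 1) ((\<omega> / \<sigma>\<^sup>2) *\<^sub>R outer_prod v v) D"
  obtains c where "(\<Sum>i<n. (c i)\<^sup>2) = \<omega>"
    "D = distr (\<Pi>\<^sub>M i\<in>{..<n}. mvnormal (c i *\<^sub>R v) (\<sigma>\<^sup>2 *\<^sub>R mat 1)) borel (gram n)"
proof -
  obtain \<mu> where \<mu>: "(\<omega> / \<sigma>\<^sup>2) *\<^sub>R outer_prod v v = matrix_inv (\<sigma>\<^sup>2 *\<^sub>R mat 1) ** gram n \<mu>"
    "D = distr (\<Pi>\<^sub>M i\<in>{..<n}. mvnormal (\<mu> i) (\<sigma>\<^sup>2 *\<^sub>R mat 1)) borel (gram n)"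
    using W unfolding noncentral_wishart_def by blast
  have "\<sigma>\<^sup>2 *\<^sub>R ((\<omega> / \<sigma>\<^sup>2) *\<^sub>R outer_prod v v) = \<sigma>\<^sup>2 *\<^sub>R ((1 / \<sigma>\<^sup>2) *\<^sub>R gram n \<mu>)"
    using s unfolding \<mu>(1) by (simp add: matrix_inv_scaleR_mat matrix_mul_scaleR_mat)
  then have g: "gram n \<mu> = \<omega> *\<^sub>R outer_prod v v" using s by simp
  have "(\<Pi>\<^sub>M i\<in>{..<n}. mvnormal (\<mu> i) (\<sigma>\<^sup>2 *\<^sub>R mat 1)) =
      (\<Pi>\<^sub>M i\<in>{..<n}. mvnormal ((v \<bullet> \<mu> i) *\<^sub>R v) (\<sigma>\<^sup>2 *\<^sub>R mat 1))"
    using rank_one_means(2)[OF v g] by (intro PiM_cong refl) auto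
  then show ?thesis using that[of "\<lambda>i. v \<bullet> \<mu> i"] rank_one_means(1)[OF v g] \<mu>(2) by metis
qed

lemma measurable_gram: "gram n \<in> borel_measurable (\<Pi>\<^sub>M i\<in>{..<n}. borel :: (real^'m) measure)"
  unfolding gram_def by measurable

text \<open>The row takes its \<open>v\<close>-component from the first vector and the rest from the
  second; \<open>distr_std_gauss_exchange\<close> makes the combination standard Gaussian before
  scaling and shifting.\<close>

lemma distr_std_gauss_mvnormal:
  fixes v :: "real^'m"
  assumes v: "norm v = 1" and s: "0 < \<sigma>"
  shows "distr (std_gauss \<Otimes>\<^sub>M std_gauss) borel
      (\<lambda>z. (c + \<sigma> * (v \<bullet> fst z)) *\<^sub>R v + \<sigma> *\<^sub>R (snd z - (v \<bullet> snd z) *\<^sub>R v)) =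
    mvnormal (c *\<^sub>R v) (\<sigma>\<^sup>2 *\<^sub>R mat 1)"
proof -
  have "distr (std_gauss \<Otimes>\<^sub>M std_gauss) borel
      (\<lambda>z. (c + \<sigma> * (v \<bullet> fst z)) *\<^sub>R v + \<sigma> *\<^sub>R (snd z - (v \<bullet> snd z) *\<^sub>R v)) =
    distr (distr (std_gauss \<Otimes>\<^sub>M std_gauss) borel (\<lambda>z. snd z - (v \<bullet> snd z) *\<^sub>R v + (v \<bullet> fst z) *\<^sub>R v))
      borel (\<lambda>x. c *\<^sub>R v + \<sigma> *\<^sub>R x)"
    by (subst distr_distr) (auto simp: comp_def algebra_simps)
  then show ?thesis by (simp add: distr_std_gauss_exchange[OF v] mvnormal_scalar[OF s])
qed

section \<open>The explicit model and its variates\<close>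

locale rank_one_model =
  fixes n :: nat and v :: "real^'m" and \<omega> :: real
  assumes n: "0 < n" and v: "norm v = 1" and \<omega>: "0 < \<omega>"
begin

abbreviation G :: "(nat \<Rightarrow> real^'m) measure" where "G \<equiv> \<Pi>\<^sub>M i\<in>{..<n}. std_gauss"

text \<open>The sample space is \<open>G \<Otimes>\<^sub>M G\<close>: the first component supplies the \<open>v\<close>-components of the rows and
  the second one the components orthogonal to \<open>v\<close>. The \<open>v\<close>-components of the second one do not enter
  \<open>Z\<close>; they only make \<open>C\<close> chi-squared where \<open>resid_dir\<close> takes its fallback value.\<close>

definition coord :: "(nat \<Rightarrow> real) \<Rightarrow> real \<Rightarrow> (nat \<Rightarrow> real^'m) \<Rightarrow> nat \<Rightarrow> real" where
  "coord c \<sigma> h i = c i + \<sigma> * (v \<bullet> h i)"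

definition sqlen :: "(nat \<Rightarrow> real) \<Rightarrow> real \<Rightarrow> (nat \<Rightarrow> real^'m) \<Rightarrow> real" where
  "sqlen c \<sigma> h = (\<Sum>i<n. (coord c \<sigma> h i)\<^sup>2)"

text \<open>The value chosen for \<open>sqlen c \<sigma> h = 0\<close> keeps the weights a unit
  vector for every \<open>h\<close>, so that the conditional law of \<open>(B, C)\<close> is the
  same without exception.\<close>

definition dir :: "(nat \<Rightarrow> real) \<Rightarrow> real \<Rightarrow> (nat \<Rightarrow> real^'m) \<Rightarrow> nat \<Rightarrow> real" where
  "dir c \<sigma> h i = (if sqlen c \<sigma> h = 0 then if i = 0 then 1 else 0 else coord c \<sigma> h i / sqrt (sqlen c \<sigma> h))"

definition bvec :: "(nat \<Rightarrow> real) \<Rightarrow> real \<Rightarrow> (nat \<Rightarrow> real^'m) \<times> (nat \<Rightarrow> real^'m) \<Rightarrow> real^'m" where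
  "bvec c \<sigma> z = (\<Sum>i<n. dir c \<sigma> (fst z) i *\<^sub>R snd z i)"

definition Z :: "(nat \<Rightarrow> real) \<Rightarrow> real \<Rightarrow> (nat \<Rightarrow> real^'m) \<times> (nat \<Rightarrow> real^'m) \<Rightarrow> nat \<Rightarrow> real^'m" where
  "Z c \<sigma> z i = coord c \<sigma> (fst z) i *\<^sub>R v + \<sigma> *\<^sub>R (snd z i - (v \<bullet> snd z i) *\<^sub>R v)"

definition A where "A c \<sigma> z = sqlen c \<sigma> (fst z) / \<sigma>\<^sup>2"
text \<open>\<open>bvec\<close> still has a component along \<open>v\<close>; removing it leaves
  \<open>m - 1\<close> degrees of freedom.\<close>

definition B where "B c \<sigma> z = bvec c \<sigma> z \<bullet> bvec c \<sigma> z - (v \<bullet> bvec c \<sigma> z)\<^sup>2"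
text \<open>The quadratic form of the residual matrix \<open>\<Sum> y y^T - b b^T\<close> in the
  unit direction \<open>resid_dir v b\<close>, written out.\<close>

definition C where "C c \<sigma> z = (\<Sum>i<n. (resid_dir v (bvec c \<sigma> z) \<bullet> snd z i)\<^sup>2) - (resid_dir v (bvec c \<sigma> z) \<bullet> bvec c \<sigma> z)\<^sup>2"
definition H where "H c \<sigma> z = gram n (Z c \<sigma> z)"
text \<open>Defined as the difference, so the expansion holds identically and only the size of
  \<open>R\<close> has to be estimated.\<close>

definition R where "R c \<sigma> z = largest_eigenvalue (H c \<sigma> z) -
  (\<sigma>\<^sup>2 * A c \<sigma> z + B c \<sigma> z * \<sigma>\<^sup>2 + (B c \<sigma> z * C c \<sigma> z) / (\<sigma>\<^sup>2 * A c \<sigma> z) * \<sigma>^4)"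

lemma prob_space_G: "prob_space G"
  by (intro prob_space_PiM prob_space_std_gauss)

lemma sqlen_nonneg: "0 \<le> sqlen c \<sigma> h"
  by (simp add: sqlen_def sum_nonneg)

lemma dir_unit: "(\<Sum>i<n. (dir c \<sigma> h i)\<^sup>2) = 1"
proof (cases "sqlen c \<sigma> h = 0")
  case True
  then have "(\<Sum>i<n. (dir c \<sigma> h i)\<^sup>2) = (\<Sum>i<n. if i = 0 then 1 else 0)"
    by (intro sum.cong) (auto simp: dir_def)
  then show ?thesis using n by simp
next
  case False
  then show ?thesis using sqlen_nonneg[of c \<sigma> h]
    by (simp add: dir_def power_divide sum_divide_distrib[symmetric] sqlen_def[symmetric])
qed

lemma measurable_coord [measurable]: "i < n \<Longrightarrow> (\<lambda>h. coord c \<sigma> h i) \<in> borel_measurable G"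
  unfolding coord_def by measurable

lemma measurable_sqlen [measurable]: "sqlen c \<sigma> \<in> borel_measurable G"
  unfolding sqlen_def by measurable

lemma measurable_dir [measurable]: "i < n \<Longrightarrow> (\<lambda>h. dir c \<sigma> h i) \<in> borel_measurable G"
  unfolding dir_def by measurable

lemma measurable_bvec [measurable]: "bvec c \<sigma> \<in> borel_measurable (G \<Otimes>\<^sub>M G)"
  unfolding bvec_def by measurable

lemma measurable_Z [measurable]: "i < n \<Longrightarrow> (\<lambda>z. Z c \<sigma> z i) \<in> borel_measurable (G \<Otimes>\<^sub>M G)"
  unfolding Z_def by measurable

lemma measurable_A [measurable]: "A c \<sigma> \<in> borel_measurable (G \<Otimes>\<^sub>M G)"
  unfolding A_def by measurable

lemma measurable_B [measurable]: "B c \<sigma> \<in> borel_measurable (G \<Otimes>\<^sub>M G)"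
  unfolding B_def by measurable

lemma measurable_C [measurable]: "C c \<sigma> \<in> borel_measurable (G \<Otimes>\<^sub>M G)"
  unfolding C_def by measurable

lemma measurable_H [measurable]: "H c \<sigma> \<in> borel_measurable (G \<Otimes>\<^sub>M G)"
proof -
  have "H c \<sigma> = (\<lambda>z. \<Sum>i<n. outer_prod (Z c \<sigma> z i) (Z c \<sigma> z i))"
    by (simp add: fun_eq_iff H_def gram_def)
  also have "\<dots> \<in> borel_measurable (G \<Otimes>\<^sub>M G)"
    by (intro borel_measurable_sum measurable_compose[OF _ measurable_outer_prod] measurable_Z) auto
  finally show ?thesis .
qed

lemma measurable_R [measurable]: "R c \<sigma> \<in> borel_measurable (G \<Otimes>\<^sub>M G)"
proof -
  have [measurable]: "(\<lambda>z. largest_eigenvalue (H c \<sigma> z)) \<in> borel_measurable (G \<Otimes>\<^sub>M G)"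
    by (rule borel_measurable_largest_eigenvalue[OF measurable_H]) (simp add: H_def transpose_gram)
  show ?thesis unfolding R_def by measurable
qed

lemma distr_H:
  assumes "0 < \<sigma>"
  shows "distr (G \<Otimes>\<^sub>M G) borel (H c \<sigma>) =
    distr (\<Pi>\<^sub>M i\<in>{..<n}. mvnormal (c i *\<^sub>R v) (\<sigma>\<^sup>2 *\<^sub>R mat 1)) borel (gram n)"
proof -
  let ?f = "\<lambda>i z. (c i + \<sigma> * (v \<bullet> fst z)) *\<^sub>R v + \<sigma> *\<^sub>R (snd z - (v \<bullet> snd z) *\<^sub>R v)"
  let ?F = "\<lambda>(x, y). \<lambda>i\<in>{..<n}. ?f i (x i, y i)"
  have F: "?F \<in> G \<Otimes>\<^sub>M G \<rightarrow>\<^sub>M (\<Pi>\<^sub>M i\<in>{..<n}. borel)"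
    unfolding split_beta by (rule measurable_restrict) measurable
  have "distr (G \<Otimes>\<^sub>M G) borel (H c \<sigma>) = distr (distr (G \<Otimes>\<^sub>M G) (\<Pi>\<^sub>M i\<in>{..<n}. borel) ?F) borel (gram n)"
    by (subst distr_distr[OF measurable_gram F])
      (auto simp: comp_def H_def gram_def Z_def coord_def split_beta intro!: distr_cong sum.cong)
  also have "distr (G \<Otimes>\<^sub>M G) (\<Pi>\<^sub>M i\<in>{..<n}. borel) ?F =
      (\<Pi>\<^sub>M i\<in>{..<n}. distr (std_gauss \<Otimes>\<^sub>M std_gauss) borel (?f i))"
    by (rule distr_PiM_map2) (auto simp: prob_space_std_gauss)
  finally show ?thesis by (simp only: distr_std_gauss_mvnormal[OF v assms])
qed

lemma noncentral_chisq_A: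
  assumes s: "0 < \<sigma>" and c: "(\<Sum>i<n. (c i)\<^sup>2) = \<omega>"
  shows "noncentral_chisq n (\<omega> / \<sigma>\<^sup>2) (distr G borel (\<lambda>h. sqlen c \<sigma> h / \<sigma>\<^sup>2))"
  unfolding noncentral_chisq_def
proof (intro exI conjI)
  \<comment> \<open>Dividing the coordinates by \<open>\<sigma>\<close> gives them means
    \<open>c i / \<sigma>\<close> and variance 1.\<close>
  show "(\<Sum>i<n. (c i / \<sigma>)\<^sup>2) = \<omega> / \<sigma>\<^sup>2"
    by (simp add: power_divide c flip: sum_divide_distrib)
  let ?F = "\<lambda>h. \<lambda>i\<in>{..<n}. c i / \<sigma> + v \<bullet> h i"
  have "distr G borel (\<lambda>h. sqlen c \<sigma> h / \<sigma>\<^sup>2) =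
      distr (distr G (\<Pi>\<^sub>M i\<in>{..<n}. borel) ?F) borel (\<lambda>g. \<Sum>i<n. (g i)\<^sup>2)"
    using s by (subst distr_distr) (auto simp: comp_def sqlen_def coord_def sum_divide_distrib
        power_divide[symmetric] add_divide_distrib intro!: distr_cong sum.cong)
  also have "distr G (\<Pi>\<^sub>M i\<in>{..<n}. borel) ?F = (\<Pi>\<^sub>M i\<in>{..<n}. distr std_gauss borel (\<lambda>x. c i / \<sigma> + v \<bullet> x))"
    by (rule distr_PiM_map) (auto simp: prob_space_std_gauss)
  also have "\<dots> = (\<Pi>\<^sub>M i\<in>{..<n}. density lborel (normal_density (c i / \<sigma>) 1))"
  proof (intro PiM_cong refl)
    fix i
    have "distr std_gauss borel (\<lambda>x. c i / \<sigma> + v \<bullet> x) =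
        distr (distr std_gauss borel (\<lambda>x. v \<bullet> x)) borel (\<lambda>x. c i / \<sigma> + x)"
      by (subst distr_distr) (auto simp: comp_def)
    then show "distr std_gauss borel (\<lambda>x. c i / \<sigma> + v \<bullet> x) = density lborel (normal_density (c i / \<sigma>) 1)"
      by (simp add: distr_std_gauss_inner[OF v] distr_std_gauss_translate)
  qed
  finally show "distr G borel (\<lambda>h. sqlen c \<sigma> h / \<sigma>\<^sup>2) =
      distr (\<Pi>\<^sub>M i\<in>{..<n}. density lborel (normal_density (c i / \<sigma>) 1)) borel (\<lambda>g. \<Sum>i<n. (g i)\<^sup>2)" .
qed

text \<open>Freezing \<open>h\<close> fixes both \<open>A\<close> and the unit weights, and for any
  unit weights the pair \<open>(B, C)\<close> has the same law; \<open>distr_pair_kernel\<close>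
  turns this into independence.\<close>

lemma distr_ABC:
  "distr (G \<Otimes>\<^sub>M G) (borel \<Otimes>\<^sub>M (borel \<Otimes>\<^sub>M borel)) (\<lambda>z. (A c \<sigma> z, B c \<sigma> z, C c \<sigma> z)) =
    distr G borel (\<lambda>h. sqlen c \<sigma> h / \<sigma>\<^sup>2) \<Otimes>\<^sub>M (chisq (CARD('m) - 1) \<Otimes>\<^sub>M chisq (n - 1))"
  unfolding A_def
proof (rule distr_pair_kernel[OF prob_space_G prob_space_G])
  fix h
  show "distr G (borel \<Otimes>\<^sub>M borel) (\<lambda>g. (B c \<sigma> (h, g), C c \<sigma> (h, g))) = chisq (CARD('m) - 1) \<Otimes>\<^sub>M chisq (n - 1)"
    using distr_direction_residual[OF v n dir_unit[of c \<sigma> h]]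
    by (simp add: B_def C_def bvec_def Let_def)
qed measurable

text \<open>This is \<open>top_singular_value_perturbation\<close> for the rows of \<open>Z\<close>,
  with \<open>bb = \<sigma> *\<^sub>R p\<close> and \<open>W = \<sigma>^4 * (B * C)\<close>, where
  \<open>p\<close> is the part of \<open>b\<close> orthogonal to \<open>v\<close>. The squared
  lengths orthogonal to \<open>v\<close> carry a factor \<open>\<sigma>\<^sup>2\<close>, so the
  cubic error is of order \<open>\<sigma>^6\<close>.\<close>

lemma R_bound:
  assumes s: "0 < \<sigma>" and a: "0 < sqlen c \<sigma> (fst z)"
    and Y: "2 * (\<sigma>\<^sup>2 * (\<Sum>i<n. (norm (snd z i))\<^sup>2)) \<le> sqlen c \<sigma> (fst z)"
  shows "\<bar>R c \<sigma> z\<bar> \<le> 2 * (\<sigma>\<^sup>2 * (\<Sum>i<n. (norm (snd z i))\<^sup>2)) ^ 3 / (sqlen c \<sigma> (fst z))\<^sup>2"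
proof -
  have vv: "v \<bullet> v = 1" using v by (simp add: norm_eq_1)
  define a where "a = sqlen c \<sigma> (fst z)"
  define q where "q = dir c \<sigma> (fst z)"
  define g where "g = snd z"
  define b where "b = bvec c \<sigma> z"
  define p where "p = b - (v \<bullet> b) *\<^sub>R v"
  define P where "P x = x - (v \<bullet> x) *\<^sub>R v" for x
  define e where "e = resid_dir v b"
  have a0: "0 < a" using a by (simp add: a_def)
  have q1: "(\<Sum>i<n. (q i)\<^sup>2) = 1" by (simp add: q_def dir_unit)
  have qx: "coord c \<sigma> (fst z) i = q i * sqrt a" for i
    using a0 by (simp add: q_def dir_def a_def[symmetric])
  have b: "b = (\<Sum>i<n. q i *\<^sub>R g i)" by (simp add: b_def bvec_def q_def g_def)
  have vP: "v \<bullet> P x = 0" for x by (simp add: P_def inner_diff_right vv)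
  have Z: "Z c \<sigma> z i = (q i * sqrt a) *\<^sub>R v + \<sigma> *\<^sub>R P (g i)" for i
    by (simp add: Z_def qx P_def g_def)
  have vZ: "v \<bullet> Z c \<sigma> z i = q i * sqrt a" for i
    by (simp add: Z inner_add_right vv vP)
  have sumP: "(\<Sum>i<n. q i *\<^sub>R P (g i)) = p"
    by (simp add: p_def b P_def scaleR_diff_right sum_subtractf inner_sum_right scaleR_sum_left)
  have bb: "(\<Sum>i<n. q i *\<^sub>R Z c \<sigma> z i) = sqrt a *\<^sub>R v + \<sigma> *\<^sub>R p"
  proof -
    have "(\<Sum>i<n. q i *\<^sub>R Z c \<sigma> z i) = (\<Sum>i<n. ((q i)\<^sup>2 * sqrt a) *\<^sub>R v + \<sigma> *\<^sub>R (q i *\<^sub>R P (g i)))"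
      by (intro sum.cong) (auto simp: Z scaleR_add_right power2_eq_square mult_ac)
    also have "\<dots> = ((\<Sum>i<n. (q i)\<^sup>2) * sqrt a) *\<^sub>R v + \<sigma> *\<^sub>R (\<Sum>i<n. q i *\<^sub>R P (g i))"
      by (simp add: sum.distrib scaleR_sum_left scaleR_sum_right sum_distrib_right)
    finally show ?thesis by (simp add: q1 sumP)
  qed
  have pv: "p \<bullet> v = 0" by (simp add: p_def inner_diff_left vv inner_commute[of b v])
  have pp: "p \<bullet> p = b \<bullet> b - (v \<bullet> b)\<^sup>2"
    by (simp add: p_def inner_diff_left inner_diff_right vv inner_commute power2_eq_square)
  have B: "B c \<sigma> z = p \<bullet> p" unfolding pp by (simp add: B_def b_def)
  \<comment> \<open>This also holds when \<open>p = 0\<close>, where \<open>e\<close> takes its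
    fallback value, since the norm is then 0.\<close>
  have pe: "p = norm p *\<^sub>R e"
    by (simp add: e_def resid_dir_def p_def[symmetric] Let_def)
  have C: "C c \<sigma> z = (\<Sum>i<n. (e \<bullet> (g i - q i *\<^sub>R b))\<^sup>2)"
  proof -
    have "(\<Sum>i<n. (e \<bullet> (g i - q i *\<^sub>R b))\<^sup>2) =
        (\<Sum>i<n. (e \<bullet> g i)\<^sup>2) - 2 * (e \<bullet> b) * (\<Sum>i<n. q i * (e \<bullet> g i)) + (e \<bullet> b)\<^sup>2 * (\<Sum>i<n. (q i)\<^sup>2)"
      by (simp add: inner_diff_right power2_diff power_mult_distrib sum.distrib sum_subtractf
          sum_distrib_left algebra_simps)
    moreover have "(\<Sum>i<n. q i * (e \<bullet> g i)) = e \<bullet> b" by (simp add: b inner_sum_right)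
    ultimately show ?thesis
      unfolding q1 by (simp add: C_def b_def[symmetric] e_def[symmetric] g_def[symmetric] power2_eq_square)
  qed
  have W: "(\<Sum>i<n. ((\<sigma> *\<^sub>R p) \<bullet> (Z c \<sigma> z i - q i *\<^sub>R (sqrt a *\<^sub>R v + \<sigma> *\<^sub>R p)))\<^sup>2) = \<sigma>^4 * (B c \<sigma> z * C c \<sigma> z)"
  proof -
    \<comment> \<open>Orthogonality of \<open>p\<close> to \<open>v\<close> lets the full vectors
      \<open>g i\<close> and \<open>b\<close> replace their projections.\<close>
    have "(\<sigma> *\<^sub>R p) \<bullet> (Z c \<sigma> z i - q i *\<^sub>R (sqrt a *\<^sub>R v + \<sigma> *\<^sub>R p)) = \<sigma>\<^sup>2 * (norm p * (e \<bullet> (g i - q i *\<^sub>R b)))" for i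
    proof -
      have "(\<sigma> *\<^sub>R p) \<bullet> (Z c \<sigma> z i - q i *\<^sub>R (sqrt a *\<^sub>R v + \<sigma> *\<^sub>R p)) = \<sigma>\<^sup>2 * (p \<bullet> g i - q i * (p \<bullet> p))"
        by (simp add: Z P_def inner_diff_right inner_add_right pv power2_eq_square algebra_simps)
      also have "p \<bullet> p = p \<bullet> b"
        by (subst (2) p_def) (simp add: inner_diff_right pv)
      also have "p \<bullet> g i - q i * (p \<bullet> b) = p \<bullet> (g i - q i *\<^sub>R b)" by (simp add: inner_diff_right)
      also have "\<dots> = norm p * (e \<bullet> (g i - q i *\<^sub>R b))" by (subst pe) simp
      finally show ?thesis .
    qed
    then show ?thesis
      by (simp add: power_mult_distrib sum_distrib_left[symmetric] C[symmetric] B power2_norm_eq_inner)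
  qed
  define Y0 where "Y0 = (\<Sum>i<n. (norm (Z c \<sigma> z i - (v \<bullet> Z c \<sigma> z i) *\<^sub>R v))\<^sup>2)"
  have Y0: "Y0 \<le> \<sigma>\<^sup>2 * (\<Sum>i<n. (norm (g i))\<^sup>2)"
    unfolding Y0_def sum_distrib_left
  proof (intro sum_mono)
    fix i
    have "P (g i) \<bullet> P (g i) = g i \<bullet> g i - (v \<bullet> g i)\<^sup>2"
      by (simp add: P_def inner_diff_left inner_diff_right vv inner_commute power2_eq_square)
    then have "(norm (P (g i)))\<^sup>2 \<le> (norm (g i))\<^sup>2" by (simp add: power2_norm_eq_inner)
    then show "(norm (Z c \<sigma> z i - (v \<bullet> Z c \<sigma> z i) *\<^sub>R v))\<^sup>2 \<le> \<sigma>\<^sup>2 * (norm (g i))\<^sup>2"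
      unfolding vZ unfolding Z by (simp add: power_mult_distrib mult_left_mono)
  qed
  have Y00: "0 \<le> Y0" by (simp add: Y0_def sum_nonneg)
  obtain u where u: "norm u = 1" "u \<bullet> (H c \<sigma> z *v u) = largest_eigenvalue (H c \<sigma> z)"
    "\<And>w. w \<bullet> (H c \<sigma> z *v w) \<le> largest_eigenvalue (H c \<sigma> z) * (w \<bullet> w)"
    using largest_eigenvalue_variational[of "H c \<sigma> z"] by (metis H_def transpose_gram)
  have "\<bar>largest_eigenvalue (H c \<sigma> z) - (a + (norm (\<sigma> *\<^sub>R p))\<^sup>2 + \<sigma>^4 * (B c \<sigma> z * C c \<sigma> z) / a)\<bar> \<le> 2 * Y0 ^ 3 / a\<^sup>2"
  proof (rule top_singular_value_perturbation[OF v _ a0 vZ bb W])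
    show "(\<Sum>i<n. (v \<bullet> Z c \<sigma> z i)\<^sup>2) = a"
      unfolding vZ using a0 by (simp add: power_mult_distrib sum_distrib_right[symmetric] q1)
    show "2 * Y0 \<le> a" using Y0 Y by (simp add: a_def g_def)
    show "(\<Sum>i<n. (u \<bullet> Z c \<sigma> z i)\<^sup>2) = largest_eigenvalue (H c \<sigma> z)"
      using u(2) by (simp add: H_def gram_quadratic_form)
    show "(\<Sum>i<n. (w \<bullet> Z c \<sigma> z i)\<^sup>2) \<le> largest_eigenvalue (H c \<sigma> z) * (w \<bullet> w)" for w
      using u(3)[of w] by (simp add: H_def gram_quadratic_form)
  qed (use u(1) in \<open>auto simp: Y0_def\<close>)
  moreover have "R c \<sigma> z = largest_eigenvalue (H c \<sigma> z) - (a + (norm (\<sigma> *\<^sub>R p))\<^sup>2 + \<sigma>^4 * (B c \<sigma> z * C c \<sigma> z) / a)"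
    using s unfolding R_def by (simp add: A_def B power_mult_distrib power2_norm_eq_inner a_def mult.commute)
  moreover have "2 * Y0 ^ 3 / a\<^sup>2 \<le> 2 * (\<sigma>\<^sup>2 * (\<Sum>i<n. (norm (g i))\<^sup>2)) ^ 3 / a\<^sup>2"
    using Y0 Y00 by (intro divide_right_mono mult_left_mono power_mono) auto
  ultimately show ?thesis by (simp add: a_def g_def)
qed

text \<open>The bound \<open>(c + x)\<^sup>2 \<ge> c\<^sup>2 / 2 - x\<^sup>2\<close> in each
  coordinate keeps the squared length away from 0 for small \<open>\<sigma>\<close>, uniformly in
  the means, which may vary with \<open>\<sigma>\<close>.\<close>

lemma sqlen_lower:
  assumes c: "(\<Sum>i<n. (c i)\<^sup>2) = \<omega>"
  shows "\<omega> / 2 - \<sigma>\<^sup>2 * (\<Sum>i<n. (v \<bullet> h i)\<^sup>2) \<le> sqlen c \<sigma> h"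
proof -
  have "\<omega> / 2 - \<sigma>\<^sup>2 * (\<Sum>i<n. (v \<bullet> h i)\<^sup>2) = (\<Sum>i<n. (c i)\<^sup>2 / 2 - \<sigma>\<^sup>2 * (v \<bullet> h i)\<^sup>2)"
    by (simp add: sum_subtractf sum_distrib_left c flip: sum_divide_distrib)
  also have "\<dots> \<le> sqlen c \<sigma> h"
    unfolding sqlen_def coord_def
  proof (intro sum_mono)
    fix i
    have "(c i + \<sigma> * (v \<bullet> h i))\<^sup>2 - ((c i)\<^sup>2 / 2 - \<sigma>\<^sup>2 * (v \<bullet> h i)\<^sup>2) = (c i + 2 * (\<sigma> * (v \<bullet> h i)))\<^sup>2 / 2"
      by (simp add: power2_eq_square field_simps)
    also have "\<dots> \<ge> 0" by simp
    finally show "(c i)\<^sup>2 / 2 - \<sigma>\<^sup>2 * (v \<bullet> h i)\<^sup>2 \<le> (c i + \<sigma> * (v \<bullet> h i))\<^sup>2" by simp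
  qed
  finally show ?thesis .
qed

text \<open>At a fixed sample point the Gaussian norms \<open>g\<close> and \<open>h\<close> are
  constants, so \<open>R_bound\<close> leaves a factor \<open>\<sigma>\<^sup>2\<close> after
  division by \<open>\<sigma>^4\<close>, whatever means are chosen for each
  \<open>\<sigma>\<close>.\<close>

lemma R_tendsto:
  assumes c: "\<And>\<sigma>. 0 < \<sigma> \<Longrightarrow> (\<Sum>i<n. (c \<sigma> i)\<^sup>2) = \<omega>"
  shows "((\<lambda>\<sigma>. R (c \<sigma>) \<sigma> z / \<sigma>^4) \<longlongrightarrow> 0) (at_right 0)"
proof (rule Lim_null_comparison)
  define g where "g = (\<Sum>i<n. (norm (snd z i))\<^sup>2)"
  define h where "h = (\<Sum>i<n. (v \<bullet> fst z i)\<^sup>2)"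
  have g0: "0 \<le> g" by (simp add: g_def sum_nonneg)
  have "((\<lambda>\<sigma>. \<sigma>\<^sup>2 * h) \<longlongrightarrow> 0\<^sup>2 * h) (at_right 0)"
    by (intro tendsto_intros)
  \<comment> \<open>The first threshold gives \<open>sqlen \<ge> \<omega> / 4\<close> by
    \<open>sqlen_lower\<close>, and the second then meets the hypothesis of
    \<open>R_bound\<close>.\<close>
  then have ev1: "\<forall>\<^sub>F \<sigma> in at_right 0. \<sigma>\<^sup>2 * h < \<omega> / 4"
    by (rule order_tendstoD(2)) (use \<omega> in simp)
  have "((\<lambda>\<sigma>. 2 * (\<sigma>\<^sup>2 * g)) \<longlongrightarrow> 2 * (0\<^sup>2 * g)) (at_right 0)"
    by (intro tendsto_intros)
  then have ev2: "\<forall>\<^sub>F \<sigma> in at_right 0. 2 * (\<sigma>\<^sup>2 * g) < \<omega> / 4"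
    by (rule order_tendstoD(2)) (use \<omega> in simp)
  \<comment> \<open>The constant is \<open>2 / (1/4)\<^sup>2 = 32\<close>.\<close>
  show "\<forall>\<^sub>F \<sigma> in at_right 0. norm (R (c \<sigma>) \<sigma> z / \<sigma>^4) \<le> \<sigma>\<^sup>2 * (32 * g^3 / \<omega>\<^sup>2)"
    using ev1 ev2 eventually_at_right_less[of 0]
  proof eventually_elim
    case (elim \<sigma>)
    define a where "a = sqlen (c \<sigma>) \<sigma> (fst z)"
    have a: "\<omega> / 4 \<le> a"
      using sqlen_lower[OF c[OF elim(3)], of \<sigma> "fst z"] elim(1) by (simp add: a_def h_def)
    then have a0: "0 < a" using \<omega> by simp
    have "\<bar>R (c \<sigma>) \<sigma> z\<bar> \<le> 2 * (\<sigma>\<^sup>2 * g) ^ 3 / a\<^sup>2"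
      using R_bound[OF elim(3), of "c \<sigma>" z] a a0 elim(2) by (simp add: a_def g_def)
    also have "\<dots> \<le> 2 * (\<sigma>\<^sup>2 * g) ^ 3 / (\<omega> / 4)\<^sup>2"
      using a \<omega> g0 by (intro divide_left_mono power_mono mult_pos_pos zero_less_power) auto
    also have "\<dots> = \<sigma>^4 * (\<sigma>\<^sup>2 * (32 * g^3 / \<omega>\<^sup>2))"
      by (simp add: power_mult_distrib power_divide flip: power_mult power_add)
    finally show ?case using elim(3) by (simp add: divide_le_eq mult.commute)
  qed
  have "((\<lambda>\<sigma>. \<sigma>\<^sup>2 * (32 * g^3 / \<omega>\<^sup>2)) \<longlongrightarrow> 0\<^sup>2 * (32 * g^3 / \<omega>\<^sup>2)) (at_right 0)"
    by (intro tendsto_intros)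
  then show "((\<lambda>\<sigma>. \<sigma>\<^sup>2 * (32 * g^3 / \<omega>\<^sup>2)) \<longlongrightarrow> 0) (at_right 0)" by simp
qed

text \<open>The theorem asks for a sample space of sequences of vectors, so a pair of \<open>n\<close>-tuples is stored as
  one \<open>2n\<close>-tuple.\<close>

definition pack :: "(nat \<Rightarrow> real^'m) \<times> (nat \<Rightarrow> real^'m) \<Rightarrow> nat \<Rightarrow> real^'m" where
  "pack z = (\<lambda>i\<in>{..<n + n}. if i < n then fst z i else snd z (i - n))"

definition unpack :: "(nat \<Rightarrow> real^'m) \<Rightarrow> (nat \<Rightarrow> real^'m) \<times> (nat \<Rightarrow> real^'m)" where
  "unpack w = (\<lambda>i\<in>{..<n}. w i, \<lambda>i\<in>{..<n}. w (n + i))"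

text \<open>As an image measure it makes the law of any function of \<open>unpack\<close> agree with
  the law under \<open>G \<Otimes>\<^sub>M G\<close>, with no product decomposition of the
  \<open>2n\<close>-fold measure.\<close>

definition Q :: "(nat \<Rightarrow> real^'m) measure" where
  "Q = distr (G \<Otimes>\<^sub>M G) (\<Pi>\<^sub>M i\<in>{..<n + n}. std_gauss) pack"

lemma measurable_pack [measurable]: "pack \<in> G \<Otimes>\<^sub>M G \<rightarrow>\<^sub>M (\<Pi>\<^sub>M i\<in>{..<n + n}. std_gauss)"
  unfolding pack_def
proof (rule measurable_restrict)
  fix i assume i: "i \<in> {..<n + n}"
  show "(\<lambda>z. if i < n then fst z i else snd z (i - n)) \<in> G \<Otimes>\<^sub>M G \<rightarrow>\<^sub>M std_gauss"
  proof (cases "i < n")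
    case False
    then have "i - n < n" using i by auto
    then show ?thesis using False by simp
  qed simp
qed

lemma measurable_unpack [measurable]: "unpack \<in> Q \<rightarrow>\<^sub>M G \<Otimes>\<^sub>M G"
  unfolding unpack_def Q_def measurable_distr_eq1
  by (intro measurable_Pair measurable_restrict measurable_component_singleton) auto

text \<open>Restricted to the space, where tuples are \<open>undefined\<close> outside
  \<open>{..<n}\<close>.\<close>

lemma unpack_pack: "z \<in> space (G \<Otimes>\<^sub>M G) \<Longrightarrow> unpack (pack z) = z"
  by (cases z) (auto simp: unpack_def pack_def space_pair_measure space_PiM PiE_def extensional_def fun_eq_iff)

lemma prob_space_Q: "prob_space Q"
proof -
  interpret GG: pair_prob_space G G
    by (simp add: pair_prob_space_def pair_sigma_finite_def prob_space_G prob_space_imp_sigma_finite)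
  show ?thesis unfolding Q_def by (rule GG.prob_space_distr) measurable
qed

lemma distr_Q:
  assumes [measurable]: "f \<in> G \<Otimes>\<^sub>M G \<rightarrow>\<^sub>M N"
  shows "distr Q N (\<lambda>w. f (unpack w)) = distr (G \<Otimes>\<^sub>M G) N f"
proof -
  have "(\<lambda>w. f (unpack w)) \<in> (\<Pi>\<^sub>M i\<in>{..<n + n}. std_gauss) \<rightarrow>\<^sub>M N"
    using measurable_compose[OF measurable_unpack assms] by (simp add: Q_def)
  then show ?thesis
    unfolding Q_def by (subst distr_distr) (auto simp: comp_def unpack_pack intro!: distr_cong)
qed

end

theorem proposition2:
  fixes v :: "real^'m" and \<omega> :: real and n :: nat
    and W :: "real \<Rightarrow> (real^'m^'m) measure"
  assumes "0 < n" and "norm v = 1" and "0 < \<omega>"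
    and "\<And>\<sigma>. 0 < \<sigma> \<Longrightarrow>
           noncentral_wishart n (\<sigma>\<^sup>2 *\<^sub>R mat 1) ((\<omega> / \<sigma>\<^sup>2) *\<^sub>R outer_prod v v) (W \<sigma>)"
  shows "\<exists>(P :: real \<Rightarrow> (nat \<Rightarrow> real^'m) measure) H A B C R.
    (\<forall>\<sigma>>0. prob_space (P \<sigma>) \<and>
       H \<sigma> \<in> borel_measurable (P \<sigma>) \<and> A \<sigma> \<in> borel_measurable (P \<sigma>) \<and>
       B \<sigma> \<in> borel_measurable (P \<sigma>) \<and> C \<sigma> \<in> borel_measurable (P \<sigma>) \<and>
       R \<sigma> \<in> borel_measurable (P \<sigma>) \<and>
       distr (P \<sigma>) borel (H \<sigma>) = W \<sigma> \<and>
       noncentral_chisq n (\<omega> / \<sigma>\<^sup>2) (distr (P \<sigma>) borel (A \<sigma>)) \<and>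
       central_chisq (CARD('m) - 1) (distr (P \<sigma>) borel (B \<sigma>)) \<and>
       central_chisq (n - 1) (distr (P \<sigma>) borel (C \<sigma>)) \<and>
       prob_space.indep_vars (P \<sigma>) (\<lambda>_. borel) (\<lambda>i. [A \<sigma>, B \<sigma>, C \<sigma>] ! i) {..<3} \<and>
       (\<forall>x\<in>space (P \<sigma>).
          largest_eigenvalue (H \<sigma> x) =
            \<sigma>\<^sup>2 * A \<sigma> x + B \<sigma> x * \<sigma>\<^sup>2 + (B \<sigma> x * C \<sigma> x) / (\<sigma>\<^sup>2 * A \<sigma> x) * \<sigma>^4 + R \<sigma> x)) \<and>
    small_op P R (\<lambda>\<sigma>. \<sigma>^4) (at_right 0)"
proof -
  interpret X: rank_one_model n v \<omega> by standard (use assms in auto)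
  \<comment> \<open>The means are chosen separately for each \<open>\<sigma>\<close>; the
    implication inside makes a total choice function possible.\<close>
  have "\<forall>\<sigma>. \<exists>c. 0 < \<sigma> \<longrightarrow> (\<Sum>i<n. (c i)\<^sup>2) = \<omega> \<and>
      W \<sigma> = distr (\<Pi>\<^sub>M i\<in>{..<n}. mvnormal (c i *\<^sub>R v) (\<sigma>\<^sup>2 *\<^sub>R mat 1)) borel (gram n)"
    using wishart_rank_one_means[OF assms(2) _ assms(4)] by metis
  then obtain c where c: "\<And>\<sigma>. 0 < \<sigma> \<Longrightarrow> (\<Sum>i<n. (c \<sigma> i)\<^sup>2) = \<omega>"
    "\<And>\<sigma>. 0 < \<sigma> \<Longrightarrow> W \<sigma> = distr (\<Pi>\<^sub>M i\<in>{..<n}. mvnormal (c \<sigma> i *\<^sub>R v) (\<sigma>\<^sup>2 *\<^sub>R mat 1)) borel (gram n)"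
    by metis
  let ?A = "\<lambda>\<sigma> w. X.A (c \<sigma>) \<sigma> (X.unpack w)" and ?B = "\<lambda>\<sigma> w. X.B (c \<sigma>) \<sigma> (X.unpack w)"
    and ?C = "\<lambda>\<sigma> w. X.C (c \<sigma>) \<sigma> (X.unpack w)" and ?H = "\<lambda>\<sigma> w. X.H (c \<sigma>) \<sigma> (X.unpack w)"
    and ?R = "\<lambda>\<sigma> w. X.R (c \<sigma>) \<sigma> (X.unpack w)"
  have main: "prob_space X.Q \<and> ?H \<sigma> \<in> borel_measurable X.Q \<and> ?A \<sigma> \<in> borel_measurable X.Q \<and>
       ?B \<sigma> \<in> borel_measurable X.Q \<and> ?C \<sigma> \<in> borel_measurable X.Q \<and>
       ?R \<sigma> \<in> borel_measurable X.Q \<and>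
       distr X.Q borel (?H \<sigma>) = W \<sigma> \<and>
       noncentral_chisq n (\<omega> / \<sigma>\<^sup>2) (distr X.Q borel (?A \<sigma>)) \<and>
       central_chisq (CARD('m) - 1) (distr X.Q borel (?B \<sigma>)) \<and>
       central_chisq (n - 1) (distr X.Q borel (?C \<sigma>)) \<and>
       prob_space.indep_vars X.Q (\<lambda>_. borel) (\<lambda>i. [?A \<sigma>, ?B \<sigma>, ?C \<sigma>] ! i) {..<3} \<and>
       (\<forall>x\<in>space X.Q. largest_eigenvalue (?H \<sigma> x) =
            \<sigma>\<^sup>2 * ?A \<sigma> x + ?B \<sigma> x * \<sigma>\<^sup>2 + (?B \<sigma> x * ?C \<sigma> x) / (\<sigma>\<^sup>2 * ?A \<sigma> x) * \<sigma>^4 + ?R \<sigma> x)"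
    if s: "0 < \<sigma>" for \<sigma>
  proof -
    let ?L = "distr X.G borel (\<lambda>h. X.sqlen (c \<sigma>) \<sigma> h / \<sigma>\<^sup>2)"
    have L: "prob_space ?L"
      by (rule prob_space.prob_space_distr[OF X.prob_space_G]) measurable
    have m: "?A \<sigma> \<in> borel_measurable X.Q" "?B \<sigma> \<in> borel_measurable X.Q" "?C \<sigma> \<in> borel_measurable X.Q"
      by measurable
    have "distr X.Q (borel \<Otimes>\<^sub>M (borel \<Otimes>\<^sub>M borel)) (\<lambda>w. (?A \<sigma> w, ?B \<sigma> w, ?C \<sigma> w)) =
        ?L \<Otimes>\<^sub>M (chisq (CARD('m) - 1) \<Otimes>\<^sub>M chisq (n - 1))"
      using X.distr_Q[of "\<lambda>z. (X.A (c \<sigma>) \<sigma> z, X.B (c \<sigma>) \<sigma> z, X.C (c \<sigma>) \<sigma> z)" "borel \<Otimes>\<^sub>M (borel \<Otimes>\<^sub>M borel)"]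
      by (simp add: X.distr_ABC)
    note ABC = indep_vars3_of_distr[OF X.prob_space_Q m L prob_space_chisq prob_space_chisq
        sets_distr sets_chisq sets_chisq this]
    have "distr X.Q borel (?H \<sigma>) = W \<sigma>"
      by (simp add: X.distr_Q X.distr_H s c)
    moreover have "noncentral_chisq n (\<omega> / \<sigma>\<^sup>2) (distr X.Q borel (?A \<sigma>))"
      unfolding ABC(1) by (rule X.noncentral_chisq_A[OF s c(1)[OF s]])
    moreover have "central_chisq (CARD('m) - 1) (distr X.Q borel (?B \<sigma>))"
      unfolding ABC(2) by (rule central_chisq_chisq)
    moreover have "central_chisq (n - 1) (distr X.Q borel (?C \<sigma>))"
      unfolding ABC(3) by (rule central_chisq_chisq)
    moreover have "?H \<sigma> \<in> borel_measurable X.Q" "?R \<sigma> \<in> borel_measurable X.Q"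
      by measurable
    ultimately show ?thesis
      using X.prob_space_Q m ABC(4) by (simp add: X.R_def)
  qed
  \<comment> \<open>One sample space serves all \<open>\<sigma>\<close>, so the pointwise limit of
    the remainder suffices.\<close>
  have op: "small_op (\<lambda>_. X.Q) ?R (\<lambda>\<sigma>. \<sigma>^4) (at_right 0)"
    by (rule small_op_pointwise[OF X.prob_space_Q _ X.R_tendsto[OF c(1)]]) measurable
  show ?thesis
    by (rule exI[where x="\<lambda>_. X.Q"], rule exI[where x="?H"], rule exI[where x="?A"], rule exI[where x="?B"],
        rule exI[where x="?C"], rule exI[where x="?R"], rule conjI[OF _ op], intro allI impI, rule main)
qed

end
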